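(* Let $S_{n,\theta}=\mathbf k_\theta[y_1,\ldots,y_n]$ be the algebra generated by $y_1,\ldots,y_n$ with relations $y_iy_j=\theta^{ij}y_jy_i$ for some multiplicatively skew-symmetric matrix $\theta=(\theta^{ij})\in\mathrm M_n(\mathbf k^* )$. Then the category $\widetilde{\mathcal S}_{n,\theta}$ is equivalent to the category $\widetilde{\mathcal S}_n$, and the abelian categories $\mathrm{Gr}^{\mathbb Z^n}\text{--}S_{n,\theta}$ and $\mathrm{Gr}^{\mathbb Z^n}\text{--}S_n$ are equivalent too.
   Context: $\mathbf k$ is a field. A matrix $\theta=(\theta^{ij})$ with entries in $\mathbf k^*$ is multiplicatively skew-symmetric if $\theta^{ji}=(\theta^{ij})^{-1}$ and $\theta^{ii}=1$. $S_n=\mathbf k[x_1,\ldots,x_n]$ is the (commutative) polynomial algebra. Both $S_n$ and $S_{n,\theta}$ are $\mathbb Z^n$-graded, with $x_i$ and $y_i$ of degree the $i$-th standard basis vector. For a $\mathbb Z^n$-graded $\mathbf k$-algebra $A$, $\mathrm{Gr}^{\mathbb Z^n}\text{--}A$ denotes the abelian category of all right $\mathbb Z^n$-graded $A$-modules (morphisms of degree zero), and $\widetilde{\mathcal A}$ denotes the $\mathbf k$-linear category with set of objects $\mathbb Z^n$, morphism spaces $\operatorname{Hom}(\bar{\mathsf p},\bar{\mathsf q})=A_{\bar{\mathsf q}-\bar{\mathsf p}}$ and composition induced by multiplication in $A$; equivalently, it is the full subcategory of $\mathrm{Gr}^{\mathbb Z^n}\text{--}A$ formed by the free modules $A(\bar{\mathsf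 p})$, $\bar{\mathsf p}\in\mathbb Z^n$, where $A(\bar{\mathsf p})_{\bar{\mathsf q}}=A_{\bar{\mathsf p}+\bar{\mathsf q}}$. The categories $\widetilde{\mathcal S}_n$ and $\widetilde{\mathcal S}_{n,\theta}$ are those associated in this way with $A=S_n$ and $A=S_{n,\theta}$. *)

theory Defs
  imports
    "HOL-Algebra.Algebraic_Closure_Type"
    "HOL-Algebra.QuotRing"
    "HOL-Library.Poly_Mapping"
    "HOL-Library.FuncSet"
    "HOL-Analysis.Finite_Cartesian_Product"
begin

unbundle no fps_syntax
unbundle no binomial_syntax

section \<open>Linear categories and their equivalence\<close>

text \<open>
  The morphisms from \<open>x\<close> to \<open>y\<close> form a vector space \<open>Homs C x y\<close> over the field \<open>'k\<close>. As usual
  for the record type \<^type>\<open>module\<close>, the fields \<open>mult\<close> and \<open>one\<close> of that vector space play no role.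
  \<open>Comp C x y z g f\<close> is the composite of \<open>f : x \<rightarrow> y\<close> followed by \<open>g : y \<rightarrow> z\<close>; the objects are
  arguments because different Hom sets need not be disjoint.
\<close>

record ('k, 'o, 'h) lin_cat =
  Obj :: "'o set"
  Homs :: "'o \<Rightarrow> 'o \<Rightarrow> ('k, 'h) module"
  Id :: "'o \<Rightarrow> 'h"
  Comp :: "'o \<Rightarrow> 'o \<Rightarrow> 'o \<Rightarrow> 'h \<Rightarrow> 'h \<Rightarrow> 'h"

abbreviation Hom :: "('k, 'o, 'h) lin_cat \<Rightarrow> 'o \<Rightarrow> 'o \<Rightarrow> 'h set" where
  "Hom C x y \<equiv> carrier (Homs C x y)"

locale linear_category =
  fixes C :: "('k :: field, 'o, 'h) lin_cat"
  assumes Homs_module: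
      "\<lbrakk>x \<in> Obj C; y \<in> Obj C\<rbrakk> \<Longrightarrow> module (ring_of_type_algebra :: 'k ring) (Homs C x y)"
    and Id_in_Hom: "x \<in> Obj C \<Longrightarrow> Id C x \<in> Hom C x x"
    and Comp_in_Hom:
      "\<lbrakk>x \<in> Obj C; y \<in> Obj C; z \<in> Obj C; f \<in> Hom C x y; g \<in> Hom C y z\<rbrakk>
        \<Longrightarrow> Comp C x y z g f \<in> Hom C x z"
    and Comp_Id_left:
      "\<lbrakk>x \<in> Obj C; y \<in> Obj C; f \<in> Hom C x y\<rbrakk> \<Longrightarrow> Comp C x y y (Id C y) f = f"
    and Comp_Id_right:
      "\<lbrakk>x \<in> Obj C; y \<in> Obj C; f \<in> Hom C x y\<rbrakk> \<Longrightarrow> Comp C x x y f (Id C x) = f"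
    and Comp_assoc:
      "\<lbrakk>w \<in> Obj C; x \<in> Obj C; y \<in> Obj C; z \<in> Obj C;
        f \<in> Hom C w x; g \<in> Hom C x y; h \<in> Hom C y z\<rbrakk>
        \<Longrightarrow> Comp C w y z h (Comp C w x y g f) = Comp C w x z (Comp C x y z h g) f"
    and Comp_add_left:
      "\<lbrakk>x \<in> Obj C; y \<in> Obj C; z \<in> Obj C;
        f \<in> Hom C x y; g \<in> Hom C y z; g' \<in> Hom C y z\<rbrakk>
        \<Longrightarrow> Comp C x y z (g \<oplus>\<^bsub>Homs C y z\<^esub> g') f
            = Comp C x y z g f \<oplus>\<^bsub>Homs C x z\<^esub> Comp C x y z g' f"
    and Comp_add_right:
      "\<lbrakk>x \<in> Obj C; y \<in> Obj C; z \<in> Obj C;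
        f \<in> Hom C x y; f' \<in> Hom C x y; g \<in> Hom C y z\<rbrakk>
        \<Longrightarrow> Comp C x y z g (f \<oplus>\<^bsub>Homs C x y\<^esub> f')
            = Comp C x y z g f \<oplus>\<^bsub>Homs C x z\<^esub> Comp C x y z g f'"
    and Comp_smult_left:
      "\<lbrakk>x \<in> Obj C; y \<in> Obj C; z \<in> Obj C; f \<in> Hom C x y; g \<in> Hom C y z\<rbrakk>
        \<Longrightarrow> Comp C x y z (c \<odot>\<^bsub>Homs C y z\<^esub> g) f = c \<odot>\<^bsub>Homs C x z\<^esub> Comp C x y z g f"
    and Comp_smult_right:
      "\<lbrakk>x \<in> Obj C; y \<in> Obj C; z \<in> Obj C; f \<in> Hom C x y; g \<in> Hom C y z\<rbrakk>
        \<Longrightarrow> Comp C x y z g (c \<odot>\<^bsub>Homs C x y\<^esub> f) = c \<odot>\<^bsub>Homs C x z\<^esub> Comp C x y z g f"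

record ('o, 'h, 'p, 'i) ftor =
  on_obj :: "'o \<Rightarrow> 'p"
  on_hom :: "'o \<Rightarrow> 'o \<Rightarrow> 'h \<Rightarrow> 'i"

locale linear_functor =
  C: linear_category C + D: linear_category D
  for C :: "('k :: field, 'o, 'h) lin_cat" and D :: "('k, 'p, 'i) lin_cat" +
  fixes F :: "('o, 'h, 'p, 'i) ftor"
  assumes on_obj_closed: "x \<in> Obj C \<Longrightarrow> on_obj F x \<in> Obj D"
    and on_hom_closed:
      "\<lbrakk>x \<in> Obj C; y \<in> Obj C; f \<in> Hom C x y\<rbrakk>
        \<Longrightarrow> on_hom F x y f \<in> Hom D (on_obj F x) (on_obj F y)"
    and on_hom_Id: "x \<in> Obj C \<Longrightarrow> on_hom F x x (Id C x) = Id D (on_obj F x)"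
    and on_hom_Comp:
      "\<lbrakk>x \<in> Obj C; y \<in> Obj C; z \<in> Obj C; f \<in> Hom C x y; g \<in> Hom C y z\<rbrakk>
        \<Longrightarrow> on_hom F x z (Comp C x y z g f)
            = Comp D (on_obj F x) (on_obj F y) (on_obj F z) (on_hom F y z g) (on_hom F x y f)"
    and on_hom_add:
      "\<lbrakk>x \<in> Obj C; y \<in> Obj C; f \<in> Hom C x y; g \<in> Hom C x y\<rbrakk>
        \<Longrightarrow> on_hom F x y (f \<oplus>\<^bsub>Homs C x y\<^esub> g)
            = on_hom F x y f \<oplus>\<^bsub>Homs D (on_obj F x) (on_obj F y)\<^esub> on_hom F x y g"
    and on_hom_smult:
      "\<lbrakk>x \<in> Obj C; y \<in> Obj C; f \<in> Hom C x y\<rbrakk>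
        \<Longrightarrow> on_hom F x y (c \<odot>\<^bsub>Homs C x y\<^esub> f)
            = c \<odot>\<^bsub>Homs D (on_obj F x) (on_obj F y)\<^esub> on_hom F x y f"

definition id_functor :: "('o, 'h, 'o, 'h) ftor" where
  "id_functor = \<lparr>on_obj = (\<lambda>x. x), on_hom = (\<lambda>x y f. f)\<rparr>"

definition comp_functor ::
    "('p, 'i, 'q, 'j) ftor \<Rightarrow> ('o, 'h, 'p, 'i) ftor \<Rightarrow> ('o, 'h, 'q, 'j) ftor" where
  "comp_functor G F =
    \<lparr>on_obj = (\<lambda>x. on_obj G (on_obj F x)),
     on_hom = (\<lambda>x y f. on_hom G (on_obj F x) (on_obj F y) (on_hom F x y f))\<rparr>"

definition is_iso :: "('k, 'o, 'h) lin_cat \<Rightarrow> 'o \<Rightarrow> 'o \<Rightarrow> 'h \<Rightarrow> bool" where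
  "is_iso C x y f \<longleftrightarrow> f \<in> Hom C x y \<and>
    (\<exists>g \<in> Hom C y x. Comp C x y x g f = Id C x \<and> Comp C y x y f g = Id C y)"

definition naturally_isomorphic ::
    "('k, 'o, 'h) lin_cat \<Rightarrow> ('k, 'p, 'i) lin_cat \<Rightarrow>
      ('o, 'h, 'p, 'i) ftor \<Rightarrow> ('o, 'h, 'p, 'i) ftor \<Rightarrow> bool" where
  "naturally_isomorphic C D F G \<longleftrightarrow>
    (\<exists>\<eta>. (\<forall>x \<in> Obj C. is_iso D (on_obj F x) (on_obj G x) (\<eta> x)) \<and>
         (\<forall>x \<in> Obj C. \<forall>y \<in> Obj C. \<forall>f \<in> Hom C x y.
            Comp D (on_obj F x) (on_obj F y) (on_obj G y) (\<eta> y) (on_hom F x y f)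
            = Comp D (on_obj F x) (on_obj G x) (on_obj G y) (on_hom G x y f) (\<eta> x)))"

definition equivalent_categories ::
    "('k :: field, 'o, 'h) lin_cat \<Rightarrow> ('k, 'p, 'i) lin_cat \<Rightarrow> bool" where
  "equivalent_categories C D \<longleftrightarrow>
    (\<exists>F G. linear_functor C D F \<and> linear_functor D C G \<and>
           naturally_isomorphic C C (comp_functor G F) id_functor \<and>
           naturally_isomorphic D D (comp_functor F G) id_functor)"


section \<open>Graded algebras, graded modules and the associated categories\<close>

record ('k, 'a, 'g) graded_algebra = "('k, 'a) module" +
  homog :: "'g \<Rightarrow> 'a set"

definition tilde_cat :: "('k, 'a, 'g :: ab_group_add) graded_algebra \<Rightarrow> ('k, 'g, 'a) lin_cat" where
  "tilde_cat A =
    \<lparr>Obj = UNIV,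
     Homs = (\<lambda>p q. \<lparr>carrier = homog A (q - p), monoid.mult = monoid.mult A, one = one A,
                     zero = zero A, add = add A, module.smult = module.smult A\<rparr>),
     Id = (\<lambda>p. \<one>\<^bsub>A\<^esub>),
     Comp = (\<lambda>p q r g f. g \<otimes>\<^bsub>A\<^esub> f)\<rparr>"

text \<open>
  The additive group of a module is the one of its \<^type>\<open>ring\<close> record; again \<open>mult\<close> and \<open>one\<close> play
  no role. The action \<open>act M m a\<close> is the right action \<open>m \<cdot> a\<close>.
\<close>

record ('a, 'm, 'g) gr_module = "'m ring" +
  act :: "'m \<Rightarrow> 'a \<Rightarrow> 'm"
  piece :: "'g \<Rightarrow> 'm set"

locale graded_right_module =
  abelian_group M
  for A :: "('k, 'a, 'g :: ab_group_add) graded_algebra" and M :: "('a, 'm, 'g) gr_module" (structure) +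
  assumes act_closed: "\<lbrakk>m \<in> carrier M; a \<in> carrier A\<rbrakk> \<Longrightarrow> act M m a \<in> carrier M"
    and act_add_left:
      "\<lbrakk>m \<in> carrier M; m' \<in> carrier M; a \<in> carrier A\<rbrakk>
        \<Longrightarrow> act M (m \<oplus> m') a = act M m a \<oplus> act M m' a"
    and act_add_right:
      "\<lbrakk>m \<in> carrier M; a \<in> carrier A; b \<in> carrier A\<rbrakk>
        \<Longrightarrow> act M m (a \<oplus>\<^bsub>A\<^esub> b) = act M m a \<oplus> act M m b"
    and act_mult:
      "\<lbrakk>m \<in> carrier M; a \<in> carrier A; b \<in> carrier A\<rbrakk>
        \<Longrightarrow> act M m (a \<otimes>\<^bsub>A\<^esub> b) = act M (act M m a) b"
    and act_one: "m \<in> carrier M \<Longrightarrow> act M m \<one>\<^bsub>A\<^esub> = m"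
    and piece_subgroup: "subgroup (piece M p) (add_monoid M)"
    and piece_decomposition:
      "m \<in> carrier M \<Longrightarrow>
        \<exists>!u. (\<forall>p. u p \<in> piece M p) \<and> finite {p. u p \<noteq> \<zero>} \<and> m = (\<Oplus>p\<in>{p. u p \<noteq> \<zero>}. u p)"
    and act_piece:
      "\<lbrakk>m \<in> piece M p; a \<in> homog A q\<rbrakk> \<Longrightarrow> act M m a \<in> piece M (p + q)"

text \<open>
  Degree-zero module homomorphisms; they are made \<^const>\<open>extensional\<close> so that equality of morphisms
  is equality of functions.
\<close>

definition gr_hom ::
    "('k, 'a, 'g) graded_algebra \<Rightarrow> ('a, 'm, 'g) gr_module \<Rightarrow> ('a, 'm, 'g) gr_module \<Rightarrow>
      ('m \<Rightarrow> 'm) set" where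
  "gr_hom A M N =
    {f \<in> carrier M \<rightarrow>\<^sub>E carrier N.
       (\<forall>m \<in> carrier M. \<forall>m' \<in> carrier M. f (m \<oplus>\<^bsub>M\<^esub> m') = f m \<oplus>\<^bsub>N\<^esub> f m') \<and>
       (\<forall>m \<in> carrier M. \<forall>a \<in> carrier A. f (act M m a) = act N (f m) a) \<and>
       (\<forall>p. f ` piece M p \<subseteq> piece N p)}"

text \<open>
  Objects are the graded right modules whose underlying set lies in the type \<open>'m\<close>. Scalars act on
  modules through the unit map \<open>c \<mapsto> c \<odot> \<one>\<close> of the algebra.
\<close>

definition gr_mod_cat ::
    "'m itself \<Rightarrow> ('k, 'a, 'g :: ab_group_add) graded_algebra \<Rightarrow>
      ('k, ('a, 'm, 'g) gr_module, 'm \<Rightarrow> 'm) lin_cat" where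
  "gr_mod_cat _ A =
    \<lparr>Obj = {M. graded_right_module A M},
     Homs = (\<lambda>M N. \<lparr>carrier = gr_hom A M N, monoid.mult = undefined, one = undefined,
                     zero = (\<lambda>m \<in> carrier M. \<zero>\<^bsub>N\<^esub>),
                     add = (\<lambda>f g. \<lambda>m \<in> carrier M. f m \<oplus>\<^bsub>N\<^esub> g m),
                     module.smult = (\<lambda>c f. \<lambda>m \<in> carrier M. act N (f m) (c \<odot>\<^bsub>A\<^esub> \<one>\<^bsub>A\<^esub>))\<rparr>),
     Id = (\<lambda>M. \<lambda>m \<in> carrier M. m),
     Comp = (\<lambda>L M N g f. compose (carrier L) g f)\<rparr>"


section \<open>The polynomial algebra and its skew version\<close>

definition monom_degree :: "('n :: finite \<Rightarrow>\<^sub>0 nat) \<Rightarrow> int ^ 'n" where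
  "monom_degree m = (\<chi> i. int (Poly_Mapping.lookup m i))"

definition poly_algebra :: "('k :: field, ('n :: finite \<Rightarrow>\<^sub>0 nat) \<Rightarrow>\<^sub>0 'k, int ^ 'n) graded_algebra" where
  "poly_algebra =
    \<lparr>carrier = UNIV, monoid.mult = (*), one = 1, zero = 0, add = (+),
     module.smult = (\<lambda>c f. Poly_Mapping.single 0 c * f),
     homog = (\<lambda>p. {f. \<forall>m \<in> Poly_Mapping.keys f. monom_degree m = p})\<rparr>"

text \<open>
  The free monoid, written additively so that \<open>'n free_mon \<Rightarrow>\<^sub>0 'k\<close>, with the convolution product, is
  the free associative algebra on the generators \<open>gen i\<close>.
\<close>

datatype 'n free_mon = Word (letters: "'n list")

instantiation free_mon :: (type) monoid_add
begin

definition zero_free_mon :: "'a free_mon" where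
  "zero_free_mon = Word []"

definition plus_free_mon :: "'a free_mon \<Rightarrow> 'a free_mon \<Rightarrow> 'a free_mon" where
  "plus_free_mon v w = Word (letters v @ letters w)"

instance
  by standard (simp_all add: zero_free_mon_def plus_free_mon_def)

end

definition word_degree :: "('n :: finite) free_mon \<Rightarrow> int ^ 'n" where
  "word_degree w = (\<chi> i. int (count_list (letters w) i))"

definition gen :: "'n \<Rightarrow> 'n free_mon \<Rightarrow>\<^sub>0 'k :: field" where
  "gen i = Poly_Mapping.single (Word [i]) 1"

definition scal :: "'k \<Rightarrow> 'n free_mon \<Rightarrow>\<^sub>0 'k :: field" where
  "scal c = Poly_Mapping.single 0 c"

definition mult_skew_symmetric :: "'k :: field ^ 'n ^ 'n \<Rightarrow> bool" where
  "mult_skew_symmetric \<theta> \<longleftrightarrow>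
    (\<forall>i j. \<theta> $ i $ j \<noteq> 0) \<and> (\<forall>i j. \<theta> $ j $ i = inverse (\<theta> $ i $ j)) \<and> (\<forall>i. \<theta> $ i $ i = 1)"

definition skew_ideal :: "'k :: field ^ 'n ^ 'n \<Rightarrow> ('n free_mon \<Rightarrow>\<^sub>0 'k) set" where
  "skew_ideal \<theta> =
    genideal ring_of_type_algebra {gen i * gen j - scal (\<theta> $ i $ j) * gen j * gen i |i j. True}"

definition skew_class ::
    "'k :: field ^ 'n ^ 'n \<Rightarrow> ('n free_mon \<Rightarrow>\<^sub>0 'k) \<Rightarrow> ('n free_mon \<Rightarrow>\<^sub>0 'k) set" where
  "skew_class \<theta> f = skew_ideal \<theta> +>\<^bsub>ring_of_type_algebra\<^esub> f"

definition skew_poly_ring :: "'k :: field ^ 'n ^ 'n \<Rightarrow> ('n free_mon \<Rightarrow>\<^sub>0 'k) set ring" where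
  "skew_poly_ring \<theta> = ring_of_type_algebra Quot skew_ideal \<theta>"

definition skew_poly_algebra ::
    "'k :: field ^ 'n ^ 'n \<Rightarrow> ('k, ('n :: finite free_mon \<Rightarrow>\<^sub>0 'k) set, int ^ 'n) graded_algebra" where
  "skew_poly_algebra \<theta> =
    \<lparr>carrier = carrier (skew_poly_ring \<theta>),
     monoid.mult = monoid.mult (skew_poly_ring \<theta>), one = one (skew_poly_ring \<theta>),
     zero = zero (skew_poly_ring \<theta>), add = add (skew_poly_ring \<theta>),
     module.smult = (\<lambda>c u. skew_class \<theta> (scal c) \<otimes>\<^bsub>skew_poly_ring \<theta>\<^esub> u),
     homog = (\<lambda>p. skew_class \<theta> ` {f. \<forall>w \<in> Poly_Mapping.keys f. word_degree w = p})\<rparr>"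

end

theory Submission
  imports Defs
begin

text \<open>
  The skew polynomial algebra and the commutative one have one-dimensional pieces in the same
  degrees, and their products differ only by scalars that depend on the degrees of the factors. This
  makes each of them a twist of the other in the sense of Zhang: there are graded linear bijections
  \<open>\<sigma> p : A \<rightarrow> B\<close>, one for each degree \<open>p\<close>, with \<open>\<sigma> p 1 = 1\<close> and
  \<open>\<sigma> p (a b) = \<sigma> p a \<cdot> \<sigma> (p + q) b\<close> for \<open>a\<close> homogeneous of degree \<open>q\<close>
  (locale \<open>twisting_system\<close>). In general none of these bijections is multiplicative,
  but the defect of one is exactly the passage to another, and categories whose objects are degrees,
  or whose objects have pieces indexed by degrees, can absorb it:

  \<^item> Applying \<open>\<sigma> (- q)\<close> to the morphisms with target \<open>q\<close> is a functor from the category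
    of \<open>A\<close> to that of \<open>B\<close>.
  \<^item> A graded \<open>B\<close>-module becomes a graded \<open>A\<close>-module when \<open>a\<close> acts on its piece of degree
    \<open>p\<close> as \<open>\<sigma> p a\<close>; graded homomorphisms remain the same functions.

  The inverse bijections again form a twisting system, in the other direction, and the functors
  that they induce are inverse to these up to natural isomorphisms whose components are identity
  maps. Hence a twisting system yields both equivalences.

  It remains to find a twisting system. Choose a bicharacter \<open>\<chi>\<close> of the degree group with
  \<open>\<chi> e_i e_j = \<theta> i j \<cdot> \<chi> e_j e_i\<close>, for instance the one whose value at \<open>(e_i, e_j)\<close> is
  \<open>\<theta> i j\<close> if \<open>i\<close> comes before \<open>j\<close> in a fixed enumeration and \<open>1\<close> otherwise. On the
  free algebra let \<open>straighten p\<close> send a word to the commutative monomial with the same letters,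
  multiplied by the \<open>\<chi>\<close>-values that arise when a vector of degree \<open>p\<close> absorbs the letters one
  after another. These maps satisfy the twisted product rule and kill the relations, so they vanish
  on the defining ideal (\<open>straighten_skew_ideal\<close>). Conversely, modulo the ideal two words
  with the same letters are proportional, so the kernel is no larger
  (\<open>unstraighten_straighten\<close>). Consequently equality in the skew polynomial algebra can be
  tested after straightening (\<open>skew_class_eq_iff\<close>), and this turns every axiom of a twisting
  system into an identity between commutative polynomials (\<open>skew_twisting_system\<close>).
\<close>

section \<open>Type-class rings and modules over a field type\<close>

lemma ring_of_type_algebra_simps [simp]:
  "carrier ring_of_type_algebra = UNIV"
  "x \<otimes>\<^bsub>ring_of_type_algebra\<^esub> y = x * y"
  "\<one>\<^bsub>ring_of_type_algebra\<^esub> = 1"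
  "\<zero>\<^bsub>ring_of_type_algebra\<^esub> = 0"
  "x \<oplus>\<^bsub>ring_of_type_algebra\<^esub> y = x + y"
  by (simp_all add: ring_of_type_algebra_def)

lemma module_over_typeI:
  fixes M :: "('k :: field, 'm, 'z) module_scheme" (structure)
  assumes "abelian_group M"
    and "\<And>c x. x \<in> carrier M \<Longrightarrow> c \<odot> x \<in> carrier M"
    and "\<And>c d x. x \<in> carrier M \<Longrightarrow> (c + d) \<odot> x = c \<odot> x \<oplus> d \<odot> x"
    and "\<And>c x y. x \<in> carrier M \<Longrightarrow> y \<in> carrier M \<Longrightarrow> c \<odot> (x \<oplus> y) = c \<odot> x \<oplus> c \<odot> y"
    and "\<And>c d x. x \<in> carrier M \<Longrightarrow> (c * d) \<odot> x = c \<odot> (d \<odot> x)"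
    and "\<And>x. x \<in> carrier M \<Longrightarrow> 1 \<odot> x = x"
  shows "module (ring_of_type_algebra :: 'k ring) M"
  using assms by (intro moduleI cring_from_type_algebra) simp_all

section \<open>Graded algebras\<close>

text \<open>
  The last axiom says that the homogeneous elements span, in the form of an induction principle:
  it reduces additive statements about algebra elements to homogeneous elements.
\<close>

locale graded_k_algebra = ring A
  for A :: "('k :: field, 'a, 'g :: ab_group_add) graded_algebra" (structure) +
  assumes algebra_module: "module (ring_of_type_algebra :: 'k ring) A"
    and smult_mult_left:
      "\<lbrakk>x \<in> carrier A; y \<in> carrier A\<rbrakk> \<Longrightarrow> (c \<odot> x) \<otimes> y = c \<odot> (x \<otimes> y)"
    and smult_mult_right:
      "\<lbrakk>x \<in> carrier A; y \<in> carrier A\<rbrakk> \<Longrightarrow> x \<otimes> (c \<odot> y) = c \<odot> (x \<otimes> y)"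
    and one_homog: "\<one> \<in> homog A 0"
    and homog_subgroup: "subgroup (homog A p) (add_monoid A)"
    and homog_smult: "x \<in> homog A p \<Longrightarrow> c \<odot> x \<in> homog A p"
    and homog_mult: "\<lbrakk>x \<in> homog A p; y \<in> homog A q\<rbrakk> \<Longrightarrow> x \<otimes> y \<in> homog A (p + q)"
    and homog_generate [consumes 1, case_names homog add]:
      "\<lbrakk>a \<in> carrier A; \<And>p x. x \<in> homog A p \<Longrightarrow> P x;
        \<And>x y. \<lbrakk>x \<in> carrier A; y \<in> carrier A; P x; P y\<rbrakk> \<Longrightarrow> P (x \<oplus> y)\<rbrakk> \<Longrightarrow> P a"
begin

sublocale scalars: module "ring_of_type_algebra :: 'k ring" A
  by (rule algebra_module)

lemmas scalar_laws = scalars.smult_closed[simplified] scalars.smult_l_distr[simplified]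
  scalars.smult_r_distr[simplified] scalars.smult_assoc1[simplified] scalars.smult_one[simplified]

lemma homog_carrier: "x \<in> homog A p \<Longrightarrow> x \<in> carrier A"
  using subgroup.subset[OF homog_subgroup] by auto

lemma homog_add: "\<lbrakk>x \<in> homog A p; y \<in> homog A p\<rbrakk> \<Longrightarrow> x \<oplus> y \<in> homog A p"
  using subgroup.m_closed[OF homog_subgroup] by auto

lemma homog_zero: "\<zero> \<in> homog A p"
  using subgroup.one_closed[OF homog_subgroup] by auto

lemma homog_minus: "x \<in> homog A p \<Longrightarrow> \<ominus> x \<in> homog A p"
  using subgroup.m_inv_closed[OF homog_subgroup] by (simp add: a_inv_def)

text \<open>
  The scalars inside the algebra, through which they act on modules. They are central of degree 0,
  which is why scalar multiples of graded homomorphisms are again graded homomorphisms.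
\<close>

abbreviation unit_map :: "'k \<Rightarrow> 'a" where
  "unit_map c \<equiv> c \<odot> \<one>"

lemma unit_map_closed: "unit_map c \<in> carrier A"
  by (simp add: scalar_laws)

lemma unit_map_homog: "unit_map c \<in> homog A 0"
  by (simp add: homog_smult one_homog)

lemma unit_map_central: "a \<in> carrier A \<Longrightarrow> unit_map c \<otimes> a = a \<otimes> unit_map c"
  by (simp add: smult_mult_left smult_mult_right)

lemma unit_map_mult: "unit_map c \<otimes> unit_map d = unit_map (c * d)"
  by (simp add: smult_mult_left scalar_laws)

end


section \<open>The linear category of a graded algebra\<close>

context graded_k_algebra
begin

lemma tilde_cat_simps [simp]:
  "Obj (tilde_cat A) = UNIV"
  "Hom (tilde_cat A) p q = homog A (q - p)"
  "Id (tilde_cat A) p = \<one>"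
  "Comp (tilde_cat A) p q r g f = g \<otimes> f"
  "add (Homs (tilde_cat A) p q) = add A"
  "zero (Homs (tilde_cat A) p q) = zero A"
  "module.smult (Homs (tilde_cat A) p q) = module.smult A"
  by (simp_all add: tilde_cat_def)

lemma linear_category_tilde_cat: "linear_category (tilde_cat A)"
proof (rule linear_category.intro)
  fix p q :: 'g
  show "module (ring_of_type_algebra :: 'k ring) (Homs (tilde_cat A) p q)"
  proof (intro module_over_typeI abelian_groupI)
    fix x assume "x \<in> Hom (tilde_cat A) p q"
    then show "\<exists>y\<in>Hom (tilde_cat A) p q. y \<oplus>\<^bsub>Homs (tilde_cat A) p q\<^esub> x = \<zero>\<^bsub>Homs (tilde_cat A) p q\<^esub>"
      by (auto simp: homog_carrier l_neg intro!: bexI[OF _ homog_minus])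
  qed (simp_all add: homog_add homog_zero homog_smult homog_carrier scalar_laws a_ac)
next
  fix p q r f g
  assume "f \<in> Hom (tilde_cat A) p q" "g \<in> Hom (tilde_cat A) q r"
  then show "Comp (tilde_cat A) p q r g f \<in> Hom (tilde_cat A) p r"
    using homog_mult[of g "r - q" f "q - p"] by simp
qed (simp_all add: one_homog homog_carrier m_assoc l_distr r_distr smult_mult_left smult_mult_right)

end


section \<open>Homogeneous components in graded modules\<close>

definition component :: "('a, 'm, 'g) gr_module \<Rightarrow> 'm \<Rightarrow> 'g \<Rightarrow> 'm" where
  "component M m =
    (THE u. (\<forall>p. u p \<in> piece M p) \<and> finite {p. u p \<noteq> \<zero>\<^bsub>M\<^esub>} \<and> m = (\<Oplus>\<^bsub>M\<^esub>p\<in>{p. u p \<noteq> \<zero>\<^bsub>M\<^esub>}. u p))"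

context graded_right_module
begin

lemma piece_carrier: "m \<in> piece M p \<Longrightarrow> m \<in> carrier M"
  using subgroup.subset[OF piece_subgroup] by auto

lemma piece_add: "\<lbrakk>m \<in> piece M p; m' \<in> piece M p\<rbrakk> \<Longrightarrow> m \<oplus> m' \<in> piece M p"
  using subgroup.m_closed[OF piece_subgroup] by auto

lemma piece_zero: "\<zero> \<in> piece M p"
  using subgroup.one_closed[OF piece_subgroup] by auto

lemma component_decomposition:
  assumes "m \<in> carrier M"
  shows component_piece: "component M m p \<in> piece M p"
    and finite_component: "finite {p. component M m p \<noteq> \<zero>}"
    and sum_component: "m = (\<Oplus>p\<in>{p. component M m p \<noteq> \<zero>}. component M m p)"
  using theI'[OF piece_decomposition[OF assms]] unfolding component_def by blast+

lemma finsum_superset: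
  assumes "finite S" "{p. u p \<noteq> \<zero>} \<subseteq> S" "\<And>p. u p \<in> carrier M"
  shows "(\<Oplus>p\<in>{p. u p \<noteq> \<zero>}. u p) = (\<Oplus>p\<in>S. u p)"
  using assms by (intro add.finprod_mono_neutral_cong_left) auto

text \<open>
  The index set \<open>S\<close> may be larger than the support, so that two elements can be decomposed over a
  common set.
\<close>

lemma component_eqI:
  assumes "\<And>p. v p \<in> piece M p" "finite S" "{p. v p \<noteq> \<zero>} \<subseteq> S" "m = (\<Oplus>p\<in>S. v p)"
  shows "component M m = v"
proof -
  have v: "v p \<in> carrier M" for p
    using assms(1) piece_carrier by blast
  have m: "m \<in> carrier M"
    using v assms(4) by simp
  have "(\<forall>p. v p \<in> piece M p) \<and> finite {p. v p \<noteq> \<zero>} \<and> m = (\<Oplus>p\<in>{p. v p \<noteq> \<zero>}. v p)"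
    using assms finsum_superset[OF assms(2,3) v] finite_subset by auto
  then show ?thesis
    using piece_decomposition[OF m] component_decomposition[OF m] by blast
qed

lemma component_of_piece:
  assumes "m \<in> piece M p"
  shows "component M m = (\<lambda>q. if q = p then m else \<zero>)"
  by (rule component_eqI[where S = "{p}"]) (use assms in \<open>auto simp: piece_zero piece_carrier\<close>)

lemma component_add:
  assumes "m \<in> carrier M" "m' \<in> carrier M"
  shows "component M (m \<oplus> m') = (\<lambda>p. component M m p \<oplus> component M m' p)"
proof -
  let ?S = "{p. component M m p \<noteq> \<zero>} \<union> {p. component M m' p \<noteq> \<zero>}"
  have S: "finite ?S"
    using assms finite_component by simp
  have c: "component M m p \<in> carrier M" "component M m' p \<in> carrier M" for p
    using assms component_piece piece_carrier by blast+
  have "m = (\<Oplus>p\<in>?S. component M m p)"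
    using sum_component[OF assms(1)] finsum_superset[OF S _ c(1)] by auto
  moreover have "m' = (\<Oplus>p\<in>?S. component M m' p)"
    using sum_component[OF assms(2)] finsum_superset[OF S _ c(2)] by auto
  ultimately have "m \<oplus> m' = (\<Oplus>p\<in>?S. component M m p \<oplus> component M m' p)"
    using c by (simp add: finsum_addf)
  then show ?thesis
    using S by (intro component_eqI[where S = ?S])
      (auto simp: assms component_piece piece_add)
qed

text \<open>
  Additive statements about elements of a graded module reduce to homogeneous elements. Once a
  twisted action is known to be additive, its other laws follow in this way from its simple form on
  pieces.
\<close>

lemma piece_induct [consumes 1, case_names piece add]:
  assumes "m \<in> carrier M"
    and piece: "\<And>p m. m \<in> piece M p \<Longrightarrow> P m"
    and add: "\<And>m m'. \<lbrakk>m \<in> carrier M; m' \<in> carrier M; P m; P m'\<rbrakk> \<Longrightarrow> P (m \<oplus> m')"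
  shows "P m"
proof -
  have "P (\<Oplus>p\<in>S. component M m p)" if "finite S" for S
    using that
  proof (induction S)
    case empty
    show ?case using piece[OF piece_zero] by simp
  next
    case (insert p S)
    have c: "component M m q \<in> piece M q" "component M m q \<in> carrier M" for q
      using component_piece[OF assms(1)] piece_carrier by blast+
    have "P (component M m p \<oplus> (\<Oplus>p\<in>S. component M m p))"
      using insert.IH c by (intro add piece[OF c(1)]) auto
    then show ?case
      using insert.hyps c by (subst finsum_insert) auto
  qed
  from this[OF finite_component[OF assms(1)]] show ?thesis
    using sum_component[OF assms(1)] by simp
qed

end

locale graded_module_over = A: graded_k_algebra A + graded_right_module A M
  for A :: "('k :: field, 'a, 'g :: ab_group_add) graded_algebra" and M :: "('a, 'm, 'g) gr_module"
    (structure)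
begin

lemma act_zero_left: "a \<in> carrier A \<Longrightarrow> act M \<zero> a = \<zero>"
  using act_add_left[of \<zero> \<zero> a] act_closed[of \<zero> a] by (metis add.l_cancel_one' l_zero zero_closed)

lemma act_unit_map_central:
  "\<lbrakk>m \<in> carrier M; a \<in> carrier A\<rbrakk>
    \<Longrightarrow> act M (act M m a) (A.unit_map c) = act M (act M m (A.unit_map c)) a"
  by (metis A.unit_map_central A.unit_map_closed act_mult)

lemma act_unit_map_piece: "m \<in> piece M p \<Longrightarrow> act M m (A.unit_map c) \<in> piece M p"
  using act_piece[of m p _ 0] A.unit_map_homog by simp

end

section \<open>The linear category of graded modules\<close>

lemma gr_homI:
  assumes "f \<in> carrier M \<rightarrow>\<^sub>E carrier N"
    and "\<And>m m'. \<lbrakk>m \<in> carrier M; m' \<in> carrier M\<rbrakk> \<Longrightarrow> f (m \<oplus>\<^bsub>M\<^esub> m') = f m \<oplus>\<^bsub>N\<^esub> f m'"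
    and "\<And>m a. \<lbrakk>m \<in> carrier M; a \<in> carrier A\<rbrakk> \<Longrightarrow> f (act M m a) = act N (f m) a"
    and "\<And>m p. m \<in> piece M p \<Longrightarrow> f m \<in> piece N p"
  shows "f \<in> gr_hom A M N"
  using assms unfolding gr_hom_def by blast

lemma gr_homD:
  assumes "f \<in> gr_hom A M N"
  shows gr_hom_funcset: "f \<in> carrier M \<rightarrow>\<^sub>E carrier N"
    and gr_hom_closed: "m \<in> carrier M \<Longrightarrow> f m \<in> carrier N"
    and gr_hom_add: "\<lbrakk>m \<in> carrier M; m' \<in> carrier M\<rbrakk> \<Longrightarrow> f (m \<oplus>\<^bsub>M\<^esub> m') = f m \<oplus>\<^bsub>N\<^esub> f m'"
    and gr_hom_act: "\<lbrakk>m \<in> carrier M; a \<in> carrier A\<rbrakk> \<Longrightarrow> f (act M m a) = act N (f m) a"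
    and gr_hom_piece: "m \<in> piece M p \<Longrightarrow> f m \<in> piece N p"
  using assms unfolding gr_hom_def by (auto simp: image_subset_iff)

lemma gr_hom_eqI:
  assumes "f \<in> gr_hom A M N" "g \<in> gr_hom A M' N'" "carrier M' = carrier M"
    and "\<And>m. m \<in> carrier M \<Longrightarrow> f m = g m"
  shows "f = g"
  using gr_hom_funcset[OF assms(1)] gr_hom_funcset[OF assms(2)] assms(3,4)
  by (intro extensionalityI[of f "carrier M" g]) (simp_all add: PiE_iff)

lemma gr_mod_cat_simps [simp]:
  "Obj (gr_mod_cat TYPE('m) A) = {M. graded_right_module A M}"
  "Hom (gr_mod_cat TYPE('m) A) M N = gr_hom A M N"
  "Id (gr_mod_cat TYPE('m) A) M = (\<lambda>m \<in> carrier M. m)"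
  "Comp (gr_mod_cat TYPE('m) A) L M N g f = compose (carrier L) g f"
  "add (Homs (gr_mod_cat TYPE('m) A) M N) = (\<lambda>f g. \<lambda>m \<in> carrier M. f m \<oplus>\<^bsub>N\<^esub> g m)"
  "zero (Homs (gr_mod_cat TYPE('m) A) M N) = (\<lambda>m \<in> carrier M. \<zero>\<^bsub>N\<^esub>)"
  "module.smult (Homs (gr_mod_cat TYPE('m) A) M N) =
    (\<lambda>c f. \<lambda>m \<in> carrier M. act N (f m) (c \<odot>\<^bsub>A\<^esub> \<one>\<^bsub>A\<^esub>))"
  by (simp_all add: gr_mod_cat_def)

context graded_k_algebra
begin

lemma gr_hom_id:
  assumes "graded_right_module A M"
  shows "(\<lambda>m \<in> carrier M. m) \<in> gr_hom A M M"
proof -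
  interpret M: graded_right_module A M by fact
  show ?thesis
    by (rule gr_homI) (simp_all add: M.act_closed M.piece_carrier)
qed

lemma gr_hom_compose:
  assumes "graded_right_module A L"
    and f: "f \<in> gr_hom A L M" and g: "g \<in> gr_hom A M N"
  shows "compose (carrier L) g f \<in> gr_hom A L N"
proof -
  interpret L: graded_right_module A L by fact
  show ?thesis
    by (rule gr_homI)
      (auto simp: compose_eq L.act_closed L.piece_carrier gr_homD[OF f] gr_homD[OF g]
        simp: compose_def)
qed

lemma gr_hom_zero:
  assumes "graded_right_module A M" "graded_right_module A N"
  shows "(\<lambda>m \<in> carrier M. \<zero>\<^bsub>N\<^esub>) \<in> gr_hom A M N"
proof -
  interpret M: graded_module_over A M by (intro graded_module_over.intro graded_k_algebra_axioms assms)
  interpret N: graded_module_over A N by (intro graded_module_over.intro graded_k_algebra_axioms assms)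
  show ?thesis
    by (rule gr_homI)
      (auto simp: M.act_closed M.piece_carrier N.piece_zero N.act_zero_left)
qed

lemma gr_hom_sum:
  assumes "graded_right_module A M" "graded_right_module A N"
    and f: "f \<in> gr_hom A M N" and g: "g \<in> gr_hom A M N"
  shows "(\<lambda>m \<in> carrier M. f m \<oplus>\<^bsub>N\<^esub> g m) \<in> gr_hom A M N"
proof -
  interpret M: graded_right_module A M by fact
  interpret N: graded_right_module A N by fact
  show ?thesis
    by (rule gr_homI)
      (auto simp: M.act_closed M.piece_carrier N.piece_add N.act_add_left N.a_ac
        gr_homD[OF f] gr_homD[OF g])
qed

lemma gr_hom_smult:
  assumes "graded_right_module A M" "graded_right_module A N"
    and f: "f \<in> gr_hom A M N"
  shows "(\<lambda>m \<in> carrier M. act N (f m) (unit_map c)) \<in> gr_hom A M N"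
proof -
  interpret M: graded_module_over A M by (intro graded_module_over.intro graded_k_algebra_axioms assms)
  interpret N: graded_module_over A N by (intro graded_module_over.intro graded_k_algebra_axioms assms)
  show ?thesis
    by (rule gr_homI)
      (auto simp: M.act_closed M.piece_carrier N.act_add_left N.act_closed unit_map_closed
        N.act_unit_map_central N.act_unit_map_piece gr_homD[OF f])
qed

text \<open>
  The negative of a homomorphism is its multiple by the scalar \<open>-1\<close>, so that closure under scalar
  multiples yields the additive inverses.
\<close>

lemma module_gr_hom:
  fixes M N :: "('a, 'm, 'g) gr_module"
  assumes "graded_right_module A M" "graded_right_module A N"
  shows "module (ring_of_type_algebra :: 'k ring) (Homs (gr_mod_cat TYPE('m) A) M N)"
proof -
  interpret M: graded_module_over A M by (intro graded_module_over.intro graded_k_algebra_axioms assms)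
  interpret N: graded_module_over A N by (intro graded_module_over.intro graded_k_algebra_axioms assms)
  note closed = gr_hom_zero[OF assms] gr_hom_sum[OF assms] gr_hom_smult[OF assms]
  have neg: "act N x (unit_map (-1)) \<oplus>\<^bsub>N\<^esub> x = \<zero>\<^bsub>N\<^esub>" if x: "x \<in> carrier N" for x
  proof -
    have zero: "act N x (unit_map 0) = \<zero>\<^bsub>N\<^esub>"
    proof -
      have "act N x (unit_map 0) = act N x (unit_map 0) \<oplus>\<^bsub>N\<^esub> act N x (unit_map 0)"
        using x by (simp add: unit_map_closed flip: N.act_add_right scalar_laws(2))
      then show ?thesis
        using N.act_closed[OF x unit_map_closed] by simp
    qed
    have "act N x (unit_map (-1)) \<oplus>\<^bsub>N\<^esub> x = act N x (unit_map (-1) \<oplus> unit_map 1)"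
      using x by (simp add: N.act_add_right unit_map_closed N.act_one scalar_laws(5))
    then show ?thesis
      using zero by (simp flip: scalar_laws(2))
  qed
  show ?thesis
  proof (intro module_over_typeI abelian_groupI, goal_cases)
    case (1 f g)
    then show ?case by (simp add: closed)
  next
    case 2
    show ?case by (simp add: closed)
  next
    case (3 f g h)
    then have "f \<in> gr_hom A M N" "g \<in> gr_hom A M N" "h \<in> gr_hom A M N" by simp_all
    note this[THEN gr_hom_closed]
    then show ?case by (auto simp: N.a_assoc intro!: restrict_ext)
  next
    case (4 f g)
    then have "f \<in> gr_hom A M N" "g \<in> gr_hom A M N" by simp_all
    note this[THEN gr_hom_closed]
    then show ?case by (auto simp: N.a_comm intro!: restrict_ext)
  next
    case (5 f)
    then have f: "f \<in> gr_hom A M N" by simp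
    have "(\<lambda>m \<in> carrier M. (\<lambda>m \<in> carrier M. \<zero>\<^bsub>N\<^esub>) m \<oplus>\<^bsub>N\<^esub> f m) = f"
      by (rule gr_hom_eqI[OF closed(2)[OF closed(1) f] f]) (simp_all add: gr_hom_closed[OF f])
    then show ?case by (simp only: gr_mod_cat_simps)
  next
    case (6 f)
    then have f: "f \<in> gr_hom A M N" by simp
    show ?case
      by (rule bexI[of _ "\<lambda>m \<in> carrier M. act N (f m) (unit_map (-1))"])
        (auto simp: closed f neg gr_hom_closed[OF f] intro!: restrict_ext)
  next
    case (7 c f)
    then show ?case by (simp add: closed)
  next
    case (8 c d f)
    then have f: "f \<in> gr_hom A M N" by simp
    show ?case
      by (auto simp: gr_hom_closed[OF f] scalar_laws(2) N.act_add_right unit_map_closed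
          intro!: restrict_ext)
  next
    case (9 c f g)
    then have "f \<in> gr_hom A M N" "g \<in> gr_hom A M N" by simp_all
    note this[THEN gr_hom_closed]
    then show ?case by (auto simp: N.act_add_left unit_map_closed intro!: restrict_ext)
  next
    case (10 c d f)
    then have f: "f \<in> gr_hom A M N" by simp
    have "act N x (unit_map (c * d)) = act N (act N x (unit_map d)) (unit_map c)"
      if "x \<in> carrier N" for x
      using that N.act_mult[OF _ unit_map_closed unit_map_closed, of x d c]
      by (simp only: unit_map_mult mult.commute[of d c])
    then show ?case
      by (auto simp: gr_hom_closed[OF f] intro!: restrict_ext)
  next
    case (11 f)
    then have f: "f \<in> gr_hom A M N" by simp
    have "(\<lambda>m \<in> carrier M. act N (f m) (unit_map 1)) = f"
      by (rule gr_hom_eqI[OF closed(3)[OF f] f])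
        (simp_all add: gr_hom_closed[OF f] scalar_laws(5) N.act_one)
    then show ?case by (simp only: gr_mod_cat_simps)
  qed
qed

lemma linear_category_gr_mod_cat: "linear_category (gr_mod_cat TYPE('m) A)"
proof (rule linear_category.intro, goal_cases)
  case (1 M N)
  then show ?case by (simp add: module_gr_hom)
next
  case (2 M)
  then show ?case by (simp add: gr_hom_id)
next
  case (3 L M N f g)
  then show ?case by (simp add: gr_hom_compose)
next
  case (4 M N f)
  then have M: "graded_right_module A M" and N: "graded_right_module A N"
    and f: "f \<in> gr_hom A M N" by simp_all
  have "compose (carrier M) (\<lambda>m \<in> carrier N. m) f = f"
    by (rule gr_hom_eqI[OF gr_hom_compose[OF M f gr_hom_id[OF N]] f])
      (simp_all add: compose_eq gr_hom_closed[OF f])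
  then show ?case by (simp only: gr_mod_cat_simps)
next
  case (5 M N f)
  then have M: "graded_right_module A M" and f: "f \<in> gr_hom A M N" by simp_all
  have "compose (carrier M) f (\<lambda>m \<in> carrier M. m) = f"
    by (rule gr_hom_eqI[OF gr_hom_compose[OF M gr_hom_id[OF M] f] f]) (simp_all add: compose_eq)
  then show ?case by (simp only: gr_mod_cat_simps)
next
  case (6 K L M N f g h)
  then have f: "f \<in> gr_hom A K L" by simp
  show ?case
    unfolding gr_mod_cat_simps compose_def
    by (rule restrict_ext) (simp add: gr_hom_closed[OF f])
next
  case (7 L M N f g g')
  then have f: "f \<in> gr_hom A L M" by simp
  show ?case
    unfolding gr_mod_cat_simps compose_def
    by (rule restrict_ext) (simp add: gr_hom_closed[OF f])
next
  case (8 L M N f f' g)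
  then have f: "f \<in> gr_hom A L M" "f' \<in> gr_hom A L M" and g: "g \<in> gr_hom A M N"
    by simp_all
  show ?case
    unfolding gr_mod_cat_simps compose_def
    by (rule restrict_ext) (simp add: f[THEN gr_hom_closed] gr_hom_add[OF g])
next
  case (9 L M N f g c)
  then have f: "f \<in> gr_hom A L M" by simp
  show ?case
    unfolding gr_mod_cat_simps compose_def
    by (rule restrict_ext) (simp add: gr_hom_closed[OF f])
next
  case (10 L M N f g c)
  then have f: "f \<in> gr_hom A L M" and g: "g \<in> gr_hom A M N" by simp_all
  show ?case
    unfolding gr_mod_cat_simps compose_def
    by (rule restrict_ext) (simp add: gr_hom_closed[OF f] gr_hom_act[OF g] unit_map_closed)
qed

end


section \<open>Twisting systems\<close>

text \<open>
  These are Zhang's twisting systems, in the form of maps between two given algebras instead of a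
  recipe for a new product on one algebra. The degree of the left factor is the shift of the index on
  the right factor.
\<close>

locale twisting_system = A: graded_k_algebra A + B: graded_k_algebra B
  for A :: "('k :: field, 'a, 'g :: ab_group_add) graded_algebra"
    and B :: "('k, 'b, 'g) graded_algebra" +
  fixes \<sigma> :: "'g \<Rightarrow> 'a \<Rightarrow> 'b"
  assumes twist_bij: "bij_betw (\<sigma> p) (carrier A) (carrier B)"
    and twist_add: "\<lbrakk>a \<in> carrier A; a' \<in> carrier A\<rbrakk> \<Longrightarrow> \<sigma> p (a \<oplus>\<^bsub>A\<^esub> a') = \<sigma> p a \<oplus>\<^bsub>B\<^esub> \<sigma> p a'"
    and twist_smult: "a \<in> carrier A \<Longrightarrow> \<sigma> p (c \<odot>\<^bsub>A\<^esub> a) = c \<odot>\<^bsub>B\<^esub> \<sigma> p a"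
    and twist_one: "\<sigma> p \<one>\<^bsub>A\<^esub> = \<one>\<^bsub>B\<^esub>"
    and twist_homog: "\<sigma> p ` homog A q = homog B q"
    and twist_mult: "\<lbrakk>a \<in> homog A q; a' \<in> carrier A\<rbrakk>
      \<Longrightarrow> \<sigma> p (a \<otimes>\<^bsub>A\<^esub> a') = \<sigma> p a \<otimes>\<^bsub>B\<^esub> \<sigma> (p + q) a'"
begin

lemma twist_closed: "a \<in> carrier A \<Longrightarrow> \<sigma> p a \<in> carrier B"
  using bij_betwE[OF twist_bij] by blast

lemma twist_homog_mem: "a \<in> homog A q \<Longrightarrow> \<sigma> p a \<in> homog B q"
  using twist_homog by blast

lemma twist_unit_map: "\<sigma> p (A.unit_map c) = B.unit_map c"
  by (simp add: twist_smult twist_one)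

definition untwist :: "'g \<Rightarrow> 'b \<Rightarrow> 'a" where
  "untwist p = inv_into (carrier A) (\<sigma> p)"

lemma untwist_closed: "b \<in> carrier B \<Longrightarrow> untwist p b \<in> carrier A"
  unfolding untwist_def by (metis bij_betw_def inv_into_into twist_bij)

lemma twist_untwist: "b \<in> carrier B \<Longrightarrow> \<sigma> p (untwist p b) = b"
  unfolding untwist_def by (metis bij_betw_inv_into_right twist_bij)

lemma untwist_twist: "a \<in> carrier A \<Longrightarrow> untwist p (\<sigma> p a) = a"
  unfolding untwist_def by (metis bij_betw_inv_into_left twist_bij)

lemma untwist_eqI: "\<lbrakk>a \<in> carrier A; b = \<sigma> p a\<rbrakk> \<Longrightarrow> untwist p b = a"
  by (simp add: untwist_twist)

lemma untwist_homog: "untwist p ` homog B q = homog A q"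
  using untwist_twist A.homog_carrier unfolding twist_homog[of p q, symmetric]
  by (force simp: image_image)

text \<open>
  The notion is symmetric: write \<open>b = \<sigma> p a\<close> and \<open>b' = \<sigma> (p + q) a'\<close>, and read the
  rule for products from right to left.
\<close>

lemma inverse_twisting_system: "twisting_system B A untwist"
proof
  show "bij_betw (untwist p) (carrier B) (carrier A)" for p
    unfolding untwist_def by (rule bij_betw_inv_into[OF twist_bij])
  show "untwist p (b \<oplus>\<^bsub>B\<^esub> b') = untwist p b \<oplus>\<^bsub>A\<^esub> untwist p b'"
    if "b \<in> carrier B" "b' \<in> carrier B" for p b b'
    using that by (intro untwist_eqI) (simp_all add: untwist_closed twist_add twist_untwist)
  show "untwist p (c \<odot>\<^bsub>B\<^esub> b) = c \<odot>\<^bsub>A\<^esub> untwist p b" if "b \<in> carrier B" for p c b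
    using that by (intro untwist_eqI)
      (simp_all add: untwist_closed twist_smult twist_untwist A.scalar_laws)
  show "untwist p \<one>\<^bsub>B\<^esub> = \<one>\<^bsub>A\<^esub>" for p
    by (intro untwist_eqI) (simp_all add: twist_one)
  show "untwist p ` homog B q = homog A q" for p q
    by (rule untwist_homog)
  show "untwist p (b \<otimes>\<^bsub>B\<^esub> b') = untwist p b \<otimes>\<^bsub>A\<^esub> untwist (p + q) b'"
    if b: "b \<in> homog B q" and b': "b' \<in> carrier B" for p q b b'
  proof (rule untwist_eqI)
    have "untwist p b \<in> homog A q"
      using b untwist_homog by blast
    then show "b \<otimes>\<^bsub>B\<^esub> b' = \<sigma> p (untwist p b \<otimes>\<^bsub>A\<^esub> untwist (p + q) b')"
      using b b' by (simp add: twist_mult untwist_closed twist_untwist B.homog_carrier)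
  qed (use b b' in \<open>simp add: untwist_closed B.homog_carrier\<close>)
qed

text \<open>
  For \<open>f : p \<rightarrow> q\<close> and \<open>g : q \<rightarrow> r\<close> the left factor of the composite \<open>g f\<close> has degree
  \<open>r - q\<close>, and \<open>\<sigma> (- r) (g f) = \<sigma> (- r) g \<cdot> \<sigma> (- r + (r - q)) f\<close>. Hence indexing
  \<open>\<sigma>\<close> by the negative of the target is compatible with composition.
\<close>

definition tilde_functor :: "('g, 'a, 'g, 'b) ftor" where
  "tilde_functor = \<lparr>on_obj = (\<lambda>p. p), on_hom = (\<lambda>p q f. \<sigma> (- q) f)\<rparr>"

lemma linear_functor_tilde: "linear_functor (tilde_cat A) (tilde_cat B) tilde_functor"
proof (intro linear_functor.intro linear_functor_axioms.intro A.linear_category_tilde_cat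
    B.linear_category_tilde_cat, goal_cases)
  case (4 p q r f g)
  then show ?case
    using twist_mult[of g "r - q" f "- r"] by (simp add: tilde_functor_def A.homog_carrier)
qed (simp_all add: tilde_functor_def twist_homog_mem twist_one twist_add twist_smult A.homog_carrier)

end

section \<open>Twisted modules\<close>

text \<open>
  The index of \<open>\<sigma>\<close> has to be the degree of the vector, so an arbitrary vector is split into its
  components first.
\<close>

definition twist_module ::
    "('g \<Rightarrow> 'a \<Rightarrow> 'b) \<Rightarrow> ('b, 'm, 'g) gr_module \<Rightarrow> ('a, 'm, 'g) gr_module" where
  "twist_module \<sigma> M =
    \<lparr>carrier = carrier M, monoid.mult = monoid.mult M, one = one M, zero = zero M, add = add M,
     act = (\<lambda>m a. \<Oplus>\<^bsub>M\<^esub>p\<in>{p. component M m p \<noteq> \<zero>\<^bsub>M\<^esub>}. act M (component M m p) (\<sigma> p a)),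
     piece = piece M\<rparr>"

lemma twist_module_simps [simp]:
  "carrier (twist_module \<sigma> M) = carrier M"
  "zero (twist_module \<sigma> M) = zero M"
  "add (twist_module \<sigma> M) = add M"
  "piece (twist_module \<sigma> M) = piece M"
  "finsum (twist_module \<sigma> M) = finsum M"
  by (simp_all add: twist_module_def finsum_def finprod_def fun_eq_iff)

lemma twist_act_def:
  "act (twist_module \<sigma> M) m a =
    (\<Oplus>\<^bsub>M\<^esub>p\<in>{p. component M m p \<noteq> \<zero>\<^bsub>M\<^esub>}. act M (component M m p) (\<sigma> p a))"
  by (simp add: twist_module_def)

context graded_module_over
begin

lemma twist_act_piece:
  assumes "m \<in> piece M p" "\<sigma> p a \<in> carrier A"
  shows "act (twist_module \<sigma> M) m a = act M m (\<sigma> p a)"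
proof (cases "m = \<zero>")
  \<comment> \<open>The zero vector lies in every piece, and no index contributes to its twisted action.\<close>
  case True
  then show ?thesis
    using component_of_piece[OF piece_zero] assms(2)
    by (simp add: twist_act_def act_zero_left)
next
  case False
  then have "{q. component M m q \<noteq> \<zero>} = {p}"
    using component_of_piece[OF assms(1)] by auto
  then show ?thesis
    using component_of_piece[OF assms(1)] piece_carrier[OF assms(1)] assms(2)
    by (simp add: twist_act_def act_closed)
qed

lemma twist_act_superset:
  assumes "m \<in> carrier M" "\<And>p. \<sigma> p a \<in> carrier A"
    and "finite S" "{p. component M m p \<noteq> \<zero>} \<subseteq> S"
  shows "act (twist_module \<sigma> M) m a = (\<Oplus>p\<in>S. act M (component M m p) (\<sigma> p a))"
  unfolding twist_act_def
  using assms piece_carrier[OF component_piece[OF assms(1)]]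
  by (intro add.finprod_mono_neutral_cong_left) (auto simp: act_zero_left act_closed)

lemma twist_act_closed:
  assumes "m \<in> carrier M" "\<And>p. \<sigma> p a \<in> carrier A"
  shows "act (twist_module \<sigma> M) m a \<in> carrier M"
  unfolding twist_act_def
  using assms component_piece[OF assms(1)] piece_carrier by (auto intro!: finsum_closed act_closed)

lemma twist_act_add_left:
  assumes m: "m \<in> carrier M" "m' \<in> carrier M" and a: "\<And>p. \<sigma> p a \<in> carrier A"
  shows "act (twist_module \<sigma> M) (m \<oplus> m') a
    = act (twist_module \<sigma> M) m a \<oplus> act (twist_module \<sigma> M) m' a"
proof -
  let ?S = "{p. component M m p \<noteq> \<zero>} \<union> {p. component M m' p \<noteq> \<zero>}"
  have S: "finite ?S"
    using m finite_component by simp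
  have c: "component M m p \<in> carrier M" "component M m' p \<in> carrier M" for p
    using m component_piece piece_carrier by blast+
  have "act (twist_module \<sigma> M) (m \<oplus> m') a
      = (\<Oplus>p\<in>?S. act M (component M (m \<oplus> m') p) (\<sigma> p a))"
    using m a S by (intro twist_act_superset) (auto simp: component_add)
  also have "\<dots> = (\<Oplus>p\<in>?S. act M (component M m p) (\<sigma> p a))
      \<oplus> (\<Oplus>p\<in>?S. act M (component M m' p) (\<sigma> p a))"
    using m a c by (simp add: component_add act_add_left act_closed finsum_addf)
  also have "\<dots> = act (twist_module \<sigma> M) m a \<oplus> act (twist_module \<sigma> M) m' a"
    using m a S by (subst (1 2) twist_act_superset[where S = ?S]) auto
  finally show ?thesis .
qed

end

context twisting_system
begin

text \<open>
  Associativity is where the rule for products enters: for \<open>m\<close> of degree \<open>p\<close> and \<open>a\<close> of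
  degree \<open>q\<close> the vector \<open>m a\<close> has degree \<open>p + q\<close>, so that \<open>b\<close> acts on it as
  \<open>\<sigma> (p + q) b\<close>.
\<close>

lemma graded_right_module_twist:
  assumes "graded_right_module B M"
  shows "graded_right_module A (twist_module \<sigma> M)"
proof -
  interpret M: graded_module_over B M
    by (intro graded_module_over.intro B.graded_k_algebra_axioms assms)
  let ?act = "act (twist_module \<sigma> M)"
  have closed: "?act m a \<in> carrier M" if "m \<in> carrier M" "a \<in> carrier A" for m a
    using that by (intro M.twist_act_closed twist_closed)
  have add_left: "?act (m \<oplus>\<^bsub>M\<^esub> m') a = ?act m a \<oplus>\<^bsub>M\<^esub> ?act m' a"
    if "m \<in> carrier M" "m' \<in> carrier M" "a \<in> carrier A" for m m' a
    using that by (intro M.twist_act_add_left twist_closed)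
  have on_piece: "?act m a = act M m (\<sigma> p a)" if "m \<in> piece M p" "a \<in> carrier A" for m p a
    using that by (intro M.twist_act_piece twist_closed)
  have add_right: "?act m (a \<oplus>\<^bsub>A\<^esub> b) = ?act m a \<oplus>\<^bsub>M\<^esub> ?act m b"
    if m: "m \<in> carrier M" and a: "a \<in> carrier A" and b: "b \<in> carrier A" for m a b
    using m
  proof (induction rule: M.piece_induct)
    case (piece p m)
    then show ?case
      using a b M.piece_carrier[OF piece]
      by (simp add: on_piece twist_add M.act_add_right twist_closed)
  next
    case (add m m')
    then show ?case
      using a b by (simp add: add_left closed M.a_ac)
  qed
  have act_piece: "?act m a \<in> piece M (p + q)" if "m \<in> piece M p" "a \<in> homog A q" for m a p q
    using that M.act_piece twist_homog_mem by (simp add: on_piece A.homog_carrier)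
  have mult: "?act m (a \<otimes>\<^bsub>A\<^esub> b) = ?act (?act m a) b"
    if m: "m \<in> carrier M" and a: "a \<in> carrier A" and b: "b \<in> carrier A" for m a b
    using m
  proof (induction rule: M.piece_induct)
    case (piece p m)
    from a show ?case
    proof (induction rule: A.homog_generate)
      case (homog q a)
      then have "?act (?act m a) b = act M (act M m (\<sigma> p a)) (\<sigma> (p + q) b)"
        using act_piece[OF piece homog] on_piece[OF piece] b A.homog_carrier
        by (simp add: on_piece[of _ "p + q"])
      then show ?case
        using piece homog b A.homog_carrier[OF homog] M.piece_carrier[OF piece]
        by (simp add: on_piece[OF piece] twist_mult M.act_mult twist_closed)
    next
      case (add a a')
      then show ?case
        using b M.piece_carrier[OF piece]
        by (simp add: A.l_distr add_right add_left closed)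
    qed
  next
    case (add m m')
    then show ?case
      using a b by (simp add: add_left closed)
  qed
  show ?thesis
  proof (intro graded_right_module.intro graded_right_module_axioms.intro)
    show "abelian_group (twist_module \<sigma> M)"
      using abelian_groupE[OF M.abelian_group_axioms] by (intro abelian_groupI) simp_all
    show "act (twist_module \<sigma> M) m \<one>\<^bsub>A\<^esub> = m" if "m \<in> carrier (twist_module \<sigma> M)" for m
      using that[simplified]
    proof (induction rule: M.piece_induct)
      case (piece p m)
      then show ?case
        using M.piece_carrier[OF piece] by (simp add: on_piece twist_one M.act_one)
    qed (simp add: add_left)
    show "subgroup (piece (twist_module \<sigma> M) p) (add_monoid (twist_module \<sigma> M))" for p
      using M.piece_subgroup[of p] by (simp add: subgroup_def m_inv_def)
  qed (use closed add_left add_right mult act_piece M.piece_decomposition in simp_all)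
qed

lemma gr_hom_twist:
  assumes "graded_right_module B M" "graded_right_module B N" and f: "f \<in> gr_hom B M N"
  shows "f \<in> gr_hom A (twist_module \<sigma> M) (twist_module \<sigma> N)"
proof -
  interpret M: graded_module_over B M
    by (intro graded_module_over.intro B.graded_k_algebra_axioms assms)
  interpret N: graded_module_over B N
    by (intro graded_module_over.intro B.graded_k_algebra_axioms assms)
  have "f (act (twist_module \<sigma> M) m a) = act (twist_module \<sigma> N) (f m) a"
    if m: "m \<in> carrier M" and a: "a \<in> carrier A" for m a
    using m
  proof (induction rule: M.piece_induct)
    case (piece p m)
    then show ?case
      using a M.piece_carrier[OF piece] gr_hom_piece[OF f piece]
      by (simp add: M.twist_act_piece N.twist_act_piece twist_closed gr_hom_act[OF f])
  next
    case (add m m')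
    then show ?case
      using a by (simp add: M.twist_act_add_left N.twist_act_add_left M.twist_act_closed
          twist_closed gr_hom_add[OF f] gr_hom_closed[OF f])
  qed
  then show ?thesis
    using gr_homD[OF f] by (intro gr_homI) auto
qed

text \<open>
  Since every \<open>\<sigma> p\<close> fixes the scalars, twisting does not change the vector space structure of the
  modules, and hence the functor below is linear.
\<close>

lemma twist_act_unit_map:
  assumes "graded_right_module B M" "m \<in> carrier M"
  shows "act (twist_module \<sigma> M) m (A.unit_map c) = act M m (B.unit_map c)"
proof -
  interpret M: graded_module_over B M
    by (intro graded_module_over.intro B.graded_k_algebra_axioms assms)
  show ?thesis
    using assms(2)
  proof (induction rule: M.piece_induct)
    case (piece p m)
    then show ?case
      by (simp add: M.twist_act_piece twist_unit_map B.unit_map_closed)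
  next
    case (add m m')
    then show ?case
      by (simp add: M.twist_act_add_left M.act_add_left twist_unit_map B.unit_map_closed)
  qed
qed

text \<open>The functor goes from \<open>B\<close>-modules to \<open>A\<close>-modules, against the direction of \<open>\<sigma>\<close>.\<close>

definition module_functor ::
    "(('b, 'm, 'g) gr_module, 'm \<Rightarrow> 'm, ('a, 'm, 'g) gr_module, 'm \<Rightarrow> 'm) ftor" where
  "module_functor = \<lparr>on_obj = twist_module \<sigma>, on_hom = (\<lambda>M N f. f)\<rparr>"

lemma linear_functor_module:
  "linear_functor (gr_mod_cat TYPE('m) B) (gr_mod_cat TYPE('m) A) module_functor"
proof (intro linear_functor.intro linear_functor_axioms.intro A.linear_category_gr_mod_cat
    B.linear_category_gr_mod_cat, goal_cases)
  case (1 M)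
  then show ?case by (simp add: module_functor_def graded_right_module_twist)
next
  case (2 M N f)
  then show ?case by (simp add: module_functor_def gr_hom_twist)
next
  case (6 M N f c)
  then have N: "graded_right_module B N" and f: "f \<in> gr_hom B M N" by simp_all
  show ?case
    by (auto simp: module_functor_def twist_act_unit_map[OF N] gr_hom_closed[OF f]
        intro!: restrict_ext)
qed (simp_all add: module_functor_def)

end

section \<open>Twisting systems give equivalences\<close>

text \<open>
  The inverse is a parameter, because both orders of composition have to be treated, and inverting
  \<open>untwist\<close> once more gives \<open>\<sigma>\<close> back only on the carrier.
\<close>

locale inverse_twisting_systems = twisting_system A B \<sigma> + inverse: twisting_system B A \<tau>
  for A :: "('k :: field, 'a, 'g :: ab_group_add) graded_algebra"
    and B :: "('k, 'b, 'g) graded_algebra" and \<sigma> \<tau> +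
  assumes left_inverse: "a \<in> carrier A \<Longrightarrow> \<tau> p (\<sigma> p a) = a"
begin

lemma tilde_functor_inverse:
  "naturally_isomorphic (tilde_cat A) (tilde_cat A)
    (comp_functor inverse.tilde_functor tilde_functor) id_functor"
proof -
  show ?thesis
    unfolding naturally_isomorphic_def is_iso_def
    by (intro exI[of _ "\<lambda>p. \<one>\<^bsub>A\<^esub>"])
      (auto simp: comp_functor_def id_functor_def tilde_functor_def inverse.tilde_functor_def
        A.one_homog left_inverse A.homog_carrier intro!: bexI[of _ "\<one>\<^bsub>A\<^esub>"])
qed

lemma double_twist_act:
  assumes "graded_right_module A M" "m \<in> carrier M" "a \<in> carrier A"
  shows "act (twist_module \<sigma> (twist_module \<tau> M)) m a = act M m a"
proof -
  interpret M: graded_module_over A M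
    by (intro graded_module_over.intro A.graded_k_algebra_axioms assms)
  interpret M': graded_module_over B "twist_module \<tau> M"
    by (intro graded_module_over.intro B.graded_k_algebra_axioms inverse.graded_right_module_twist assms)
  show ?thesis
    using assms(2)
  proof (induction rule: M.piece_induct)
    case (piece p m)
    then show ?case
      using assms(3)
      by (simp add: M'.twist_act_piece[where p = p] M.twist_act_piece twist_closed left_inverse)
  next
    case (add m m')
    then show ?case
      using assms(3) M'.twist_act_add_left[of m m' \<sigma> a]
      by (simp add: M.act_add_left twist_closed)
  qed
qed

text \<open>
  The double twist of a module is not equal to it, since the two actions may differ outside the
  carriers; but the identity function is an isomorphism between them.
\<close>

lemma module_functor_inverse:
  "naturally_isomorphic (gr_mod_cat TYPE('m) A) (gr_mod_cat TYPE('m) A)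
    (comp_functor module_functor inverse.module_functor) id_functor"
proof -
  let ?F = "\<lambda>M :: ('a, 'm, 'g) gr_module. twist_module \<sigma> (twist_module \<tau> M)"
  have hom: "(\<lambda>m \<in> carrier M. m) \<in> gr_hom A (?F M) M" "(\<lambda>m \<in> carrier M. m) \<in> gr_hom A M (?F M)"
    if M: "graded_right_module A M" for M :: "('a, 'm, 'g) gr_module"
  proof -
    interpret M: graded_right_module A M by fact
    show "(\<lambda>m \<in> carrier M. m) \<in> gr_hom A (?F M) M" "(\<lambda>m \<in> carrier M. m) \<in> gr_hom A M (?F M)"
      by (auto intro!: gr_homI simp: double_twist_act[OF M] M.act_closed M.piece_carrier)
  qed
  show ?thesis
    unfolding naturally_isomorphic_def is_iso_def
  proof (intro exI[of _ "\<lambda>M. \<lambda>m \<in> carrier M. m"] conjI ballI, goal_cases)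
    case (1 M)
    then show ?case
      by (simp add: comp_functor_def id_functor_def module_functor_def inverse.module_functor_def hom)
  next
    case (2 M)
    then show ?case
      by (auto simp: comp_functor_def id_functor_def module_functor_def inverse.module_functor_def
          hom compose_eq compose_def intro!: bexI[of _ "\<lambda>m \<in> carrier M. m"])
  next
    case (3 M N f)
    then have f: "f \<in> gr_hom A M N" by simp
    show ?case
      by (auto simp: comp_functor_def id_functor_def module_functor_def inverse.module_functor_def
          compose_def gr_hom_closed[OF f] intro!: restrict_ext)
  qed
qed

end

theorem (in twisting_system)
  shows tilde_cat_equivalent: "equivalent_categories (tilde_cat A) (tilde_cat B)"
    and gr_mod_cat_equivalent:
      "equivalent_categories (gr_mod_cat TYPE('m) A) (gr_mod_cat TYPE('m) B)"
proof -
  note inverse = inverse_twisting_systems.intro[OF _ _ inverse_twisting_systems_axioms.intro]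
  note AB = inverse[OF twisting_system_axioms inverse_twisting_system untwist_twist]
  note BA = inverse[OF inverse_twisting_system twisting_system_axioms twist_untwist]
  show "equivalent_categories (tilde_cat A) (tilde_cat B)"
    unfolding equivalent_categories_def
    using linear_functor_tilde twisting_system.linear_functor_tilde[OF inverse_twisting_system]
      inverse_twisting_systems.tilde_functor_inverse[OF AB]
      inverse_twisting_systems.tilde_functor_inverse[OF BA]
    by blast
  show "equivalent_categories (gr_mod_cat TYPE('m) A) (gr_mod_cat TYPE('m) B)"
    unfolding equivalent_categories_def
    using linear_functor_module twisting_system.linear_functor_module[OF inverse_twisting_system]
      inverse_twisting_systems.module_functor_inverse[OF AB]
      inverse_twisting_systems.module_functor_inverse[OF BA]
    by blast
qed

section \<open>Quotients of monoid algebras as graded algebras\<close>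

lemma poly_mapping_additive_induct [consumes 1, case_names zero single add]:
  fixes f :: "'w \<Rightarrow>\<^sub>0 'c :: comm_monoid_add"
  assumes "Poly_Mapping.keys f \<subseteq> K"
    and zero: "P 0"
    and single: "\<And>w c. w \<in> K \<Longrightarrow> P (Poly_Mapping.single w c)"
    and add: "\<And>f g. P f \<Longrightarrow> P g \<Longrightarrow> P (f + g)"
  shows "P f"
proof -
  have "P (\<Sum>w\<in>S. Poly_Mapping.single w (Poly_Mapping.lookup f w))" if "finite S" "S \<subseteq> K" for S
    using that by (induction S) (auto intro: zero single add)
  moreover have "f = (\<Sum>w\<in>Poly_Mapping.keys f. Poly_Mapping.single w (Poly_Mapping.lookup f w))"
    by (rule poly_mapping_eqI)
      (simp add: lookup_sum lookup_single when_def in_keys_iff)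
  ultimately show ?thesis
    using assms(1) by (metis finite_keys)
qed

lemma single_0_central:
  fixes f :: "'w :: monoid_add \<Rightarrow>\<^sub>0 'k :: comm_ring_1"
  shows "f * Poly_Mapping.single 0 c = Poly_Mapping.single 0 c * f"
  using subset_UNIV by (induction f rule: poly_mapping_additive_induct)
    (simp_all add: mult_single algebra_simps)

lemma ring_of_noncommutative_type: "ring (ring_of_type_algebra :: 'a :: ring_1 ring)"
proof (intro ringI abelian_groupI monoidI; simp add: algebra_simps)
  show "\<exists>y. x + y = 0" for x :: 'a
    by (rule exI[of _ "- x"]) simp
qed

lemma a_inv_ring_of_type [simp]: "\<ominus>\<^bsub>ring_of_type_algebra\<^esub> x = - (x :: 'a :: ring_1)"
proof -
  interpret ring "ring_of_type_algebra :: 'a ring" by (rule ring_of_noncommutative_type)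
  show ?thesis by (rule minus_equality) simp_all
qed

text \<open>
  Every identity of the algebra \<open>A\<close> is inherited from the monoid algebra through the surjection
  \<open>cl\<close>. The polynomial algebra is the case of the identity map on the monoid algebra of commutative
  monomials, the skew polynomial algebra that of the class map on the free algebra.
\<close>

lemma graded_k_algebra_quotientI:
  fixes A :: "('k :: field, 'a, 'g :: ab_group_add) graded_algebra" (structure)
    and cl :: "('w :: monoid_add \<Rightarrow>\<^sub>0 'k) \<Rightarrow> 'a" and deg :: "'w \<Rightarrow> 'g"
  assumes cl_carrier: "carrier A = range cl"
    and cl_one: "\<one> = cl 1" and cl_zero: "\<zero> = cl 0"
    and cl_add: "\<And>f g. cl f \<oplus> cl g = cl (f + g)"
    and cl_mult: "\<And>f g. cl f \<otimes> cl g = cl (f * g)"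
    and cl_smult: "\<And>c f. c \<odot> cl f = cl (Poly_Mapping.single 0 c * f)"
    and cl_homog: "\<And>p. homog A p = cl ` {f. \<forall>w \<in> Poly_Mapping.keys f. deg w = p}"
    and cl_deg: "deg 0 = 0" "\<And>v w. deg (v + w) = deg v + deg w"
  shows "graded_k_algebra A"
proof -
  have neg: "cl (- f) \<oplus> cl f = \<zero>" for f
    by (simp add: cl_add cl_zero)
  have abelian: "abelian_group A"
  proof (rule abelian_groupI)
    show "\<exists>y\<in>carrier A. y \<oplus> x = \<zero>" if "x \<in> carrier A" for x
      using that neg by (auto simp: cl_carrier)
  qed (auto simp: cl_carrier cl_add cl_zero algebra_simps)
  interpret ring A
    by (intro ringI abelian monoidI) (auto simp: cl_carrier cl_add cl_mult cl_one algebra_simps)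
  have a_inv: "\<ominus> cl f = cl (- f)" for f
    by (rule minus_equality) (auto simp: neg cl_carrier)
  have single_single: "Poly_Mapping.single 0 (c * d) * f
      = Poly_Mapping.single 0 c * (Poly_Mapping.single 0 d * f)"
    for c d :: 'k and f :: "'w \<Rightarrow>\<^sub>0 'k"
    by (simp add: mult_single flip: mult.assoc)
  have homogI: "cl f \<in> homog A p" if "\<forall>w \<in> Poly_Mapping.keys f. deg w = p" for f p
    using that by (auto simp: cl_homog)
  have homogE: "\<exists>f. x = cl f \<and> (\<forall>w \<in> Poly_Mapping.keys f. deg w = p)" if "x \<in> homog A p" for x p
    using that by (auto simp: cl_homog)
  show ?thesis
  proof (intro graded_k_algebra.intro graded_k_algebra_axioms.intro ring_axioms)
    show "module (ring_of_type_algebra :: 'k ring) A"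
      by (rule module_over_typeI[OF abelian])
        (auto simp: cl_carrier cl_add cl_smult single_add single_single distrib_left distrib_right)
    show "(c \<odot> x) \<otimes> y = c \<odot> (x \<otimes> y)" if "x \<in> carrier A" "y \<in> carrier A" for x y c
      using that by (auto simp: cl_carrier cl_smult cl_mult mult.assoc)
    have "f * (Poly_Mapping.single 0 c * g) = Poly_Mapping.single 0 c * (f * g)"
      for f g :: "'w \<Rightarrow>\<^sub>0 'k" and c
      by (simp add: single_0_central flip: mult.assoc)
    then show "x \<otimes> (c \<odot> y) = c \<odot> (x \<otimes> y)" if "x \<in> carrier A" "y \<in> carrier A" for x y c
      using that by (auto simp: cl_carrier cl_smult cl_mult)
    show "\<one> \<in> homog A 0"
      unfolding cl_one by (rule homogI) (simp add: cl_deg)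
    show "subgroup (homog A p) (add_monoid A)" for p
    proof
      show "homog A p \<subseteq> carrier (add_monoid A)"
        by (auto simp: cl_homog cl_carrier)
      show "\<one>\<^bsub>add_monoid A\<^esub> \<in> homog A p"
        using homogI[of 0 p] unfolding cl_zero[symmetric] by simp
      show "x \<otimes>\<^bsub>add_monoid A\<^esub> y \<in> homog A p" if "x \<in> homog A p" "y \<in> homog A p" for x y
      proof -
        from homogE[OF that(1)] homogE[OF that(2)] obtain f g where "x = cl f" "y = cl g"
          and "\<forall>w \<in> Poly_Mapping.keys f. deg w = p" "\<forall>w \<in> Poly_Mapping.keys g. deg w = p"
          by blast
        then show ?thesis
          using keys_add[of f g] by (auto simp: cl_add intro!: homogI)
      qed
      show "inv\<^bsub>add_monoid A\<^esub> x \<in> homog A p" if "x \<in> homog A p" for x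
        using homogE[OF that] by (auto simp: a_inv in_keys_iff simp flip: a_inv_def intro!: homogI)
    qed
    show "c \<odot> x \<in> homog A p" if "x \<in> homog A p" for c x p
    proof -
      from homogE[OF that] obtain f
        where "x = cl f" "\<forall>w \<in> Poly_Mapping.keys f. deg w = p"
        by blast
      then show ?thesis
        using keys_mult[of "Poly_Mapping.single 0 c" f]
        by (auto simp: cl_smult intro!: homogI split: if_splits)
    qed
    show "x \<otimes> y \<in> homog A (p + q)" if "x \<in> homog A p" "y \<in> homog A q" for x y p q
    proof -
      from homogE[OF that(1)] homogE[OF that(2)] obtain f g where "x = cl f" "y = cl g"
        and "\<forall>w \<in> Poly_Mapping.keys f. deg w = p" "\<forall>w \<in> Poly_Mapping.keys g. deg w = q"
        by blast
      then show ?thesis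
        using keys_mult[of f g] by (fastforce simp: cl_mult cl_deg intro!: homogI)
    qed
    show "P a"
      if "a \<in> carrier A" and base: "\<And>p x. x \<in> homog A p \<Longrightarrow> P x"
        and step: "\<And>x y. \<lbrakk>x \<in> carrier A; y \<in> carrier A; P x; P y\<rbrakk> \<Longrightarrow> P (x \<oplus> y)" for a P
    proof -
      have "P (cl f)" for f
        using subset_UNIV
      proof (induction f rule: poly_mapping_additive_induct)
        case zero
        show ?case by (rule base[of _ 0]) (auto intro!: homogI)
      next
        case (single w c)
        show ?case by (rule base[of _ "deg w"]) (auto intro!: homogI split: if_splits)
      next
        case (add f g)
        then show ?case using step[of "cl f" "cl g"] by (simp add: cl_carrier cl_add)
      qed
      then show ?thesis using that(1) by (auto simp: cl_carrier)
    qed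
  qed
qed


section \<open>Monomial maps\<close>

text \<open>
  The linear maps that send each basis vector \<open>v\<close> to the multiple \<open>s v\<close> of the basis vector
  \<open>\<kappa> v\<close>; straightening and its section are both of this kind.
\<close>

definition monomial_map ::
    "('v \<Rightarrow> 'w) \<Rightarrow> ('v \<Rightarrow> 'k) \<Rightarrow> ('v \<Rightarrow>\<^sub>0 'k) \<Rightarrow> ('w \<Rightarrow>\<^sub>0 'k :: comm_ring)" where
  "monomial_map \<kappa> s f =
    (\<Sum>v\<in>Poly_Mapping.keys f. Poly_Mapping.single (\<kappa> v) (s v * Poly_Mapping.lookup f v))"

lemma monomial_map_superset:
  assumes "finite S" "Poly_Mapping.keys f \<subseteq> S"
  shows "monomial_map \<kappa> s f = (\<Sum>v\<in>S. Poly_Mapping.single (\<kappa> v) (s v * Poly_Mapping.lookup f v))"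
  unfolding monomial_map_def using assms
  by (intro sum.mono_neutral_left) (auto simp: in_keys_iff)

lemma monomial_map_zero [simp]: "monomial_map \<kappa> s 0 = 0"
  by (simp add: monomial_map_def)

lemma monomial_map_single [simp]:
  "monomial_map \<kappa> s (Poly_Mapping.single v c) = Poly_Mapping.single (\<kappa> v) (s v * c)"
  by (subst monomial_map_superset[of "{v}"]) auto

lemma monomial_map_add: "monomial_map \<kappa> s (f + g) = monomial_map \<kappa> s f + monomial_map \<kappa> s g"
proof -
  let ?S = "Poly_Mapping.keys f \<union> Poly_Mapping.keys g"
  show ?thesis
    using keys_add[of f g]
    by (subst (1 2 3) monomial_map_superset[of ?S])
      (auto simp: lookup_add distrib_left single_add sum.distrib)
qed

lemma monomial_map_diff: "monomial_map \<kappa> s (f - g) = monomial_map \<kappa> s f - monomial_map \<kappa> s g"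
  using monomial_map_add[of \<kappa> s "f - g" g] by (simp add: algebra_simps)

lemma keys_monomial_map:
  "w \<in> Poly_Mapping.keys (monomial_map \<kappa> s f) \<Longrightarrow> \<exists>v \<in> Poly_Mapping.keys f. w = \<kappa> v"
  unfolding monomial_map_def using keys_sum by (fastforce split: if_splits)

section \<open>Words and commutative monomials\<close>

lemma letters_0 [simp]: "letters 0 = []"
  by (simp add: zero_free_mon_def)

lemma letters_plus [simp]: "letters (v + w) = letters v @ letters w"
  by (simp add: plus_free_mon_def)

lemma word_degree_0: "word_degree 0 = 0"
  by (simp add: word_degree_def zero_free_mon_def vec_eq_iff)

lemma word_degree_plus: "word_degree (v + w) = word_degree v + word_degree w"
  by (simp add: word_degree_def plus_free_mon_def vec_eq_iff)

lemma word_degree_Cons: "word_degree (Word (i # w)) = axis i 1 + word_degree (Word w)"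
  by (simp add: word_degree_def axis_def vec_eq_iff)

lemma monom_degree_0: "monom_degree 0 = 0"
  by (simp add: monom_degree_def vec_eq_iff)

lemma monom_degree_plus: "monom_degree (m + m') = monom_degree m + monom_degree m'"
  by (simp add: monom_degree_def lookup_add vec_eq_iff)

definition word_content :: "'n :: finite free_mon \<Rightarrow> ('n \<Rightarrow>\<^sub>0 nat)" where
  "word_content w = Abs_poly_mapping (count_list (letters w))"

lemma lookup_word_content [simp]: "Poly_Mapping.lookup (word_content w) i = count_list (letters w) i"
  by (simp add: word_content_def)

lemma word_content_0 [simp]: "word_content 0 = 0"
  by (rule poly_mapping_eqI) (simp add: zero_free_mon_def)

lemma word_content_plus: "word_content (v + w) = word_content v + word_content w"
  by (rule poly_mapping_eqI) (simp add: plus_free_mon_def lookup_add)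

lemma monom_degree_word_content [simp]: "monom_degree (word_content w) = word_degree w"
  by (simp add: monom_degree_def word_degree_def)

lemma ex_word_content: "\<exists>w. word_content w = m"
  using subset_UNIV
proof (induction m rule: poly_mapping_additive_induct)
  case zero
  show ?case by (rule exI[of _ 0]) simp
next
  case (single i c)
  have "word_content (Word (replicate c i)) = Poly_Mapping.single i c"
  proof (rule poly_mapping_eqI)
    show "Poly_Mapping.lookup (word_content (Word (replicate c i))) k
        = Poly_Mapping.lookup (Poly_Mapping.single i c) k" for k
      by (induction c) (auto simp: lookup_single when_def)
  qed
  then show ?case by blast
next
  case (add m m')
  then show ?case by (metis word_content_plus)
qed

text \<open>
  Any choice of one word for each monomial serves as a normal form; words with
  the same letters will turn out to be proportional modulo the defining ideal.
\<close>

definition normal_word :: "('n :: finite \<Rightarrow>\<^sub>0 nat) \<Rightarrow> 'n free_mon" where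
  "normal_word m = (SOME w. word_content w = m)"

lemma word_content_normal_word [simp]: "word_content (normal_word m) = m"
  unfolding normal_word_def by (rule someI_ex[OF ex_word_content])

text \<open>The index type carries no order, so an enumeration is chosen to say which letter comes first.\<close>

definition index :: "'n :: finite \<Rightarrow> nat" where
  "index = (SOME f. inj f)"

lemma inj_index: "inj (index :: 'n :: finite \<Rightarrow> nat)"
proof -
  obtain f :: "'n \<Rightarrow> nat" where "inj f"
    using finite_imp_inj_to_nat_seg[OF finite[of "UNIV :: 'n set"]] by metis
  then show ?thesis
    unfolding index_def by (rule someI[where P = inj])
qed

section \<open>Weights of words\<close>

locale skew_parameters =
  fixes \<theta> :: "'k :: field ^ 'n ^ 'n"
  assumes skew: "mult_skew_symmetric \<theta>"
begin

text \<open>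
  \<open>exchange i j\<close> is the value \<open>\<chi> e_i e_j\<close> of the bicharacter, and \<open>letter_weight i p\<close> is
  \<open>\<chi> p e_i\<close>. The weight of a word at \<open>p\<close> accumulates one factor for each letter, at the
  degree reached just before that letter.
\<close>

definition exchange :: "'n \<Rightarrow> 'n \<Rightarrow> 'k" where
  "exchange i j = (if index i < index j then \<theta> $ i $ j else 1)"

definition letter_weight :: "'n \<Rightarrow> int ^ 'n \<Rightarrow> 'k" where
  "letter_weight i p = (\<Prod>j\<in>UNIV. exchange j i powi (p $ j))"

primrec weight :: "int ^ 'n \<Rightarrow> 'n list \<Rightarrow> 'k" where
  "weight p [] = 1"
| "weight p (i # w) = letter_weight i p * weight (p + axis i 1) w"

lemma skew_nonzero: "\<theta> $ i $ j \<noteq> 0"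
  and skew_diagonal: "\<theta> $ i $ i = 1"
  and skew_inverse: "\<theta> $ j $ i = inverse (\<theta> $ i $ j)"
  using skew unfolding mult_skew_symmetric_def by blast+

lemma exchange_nonzero: "exchange i j \<noteq> 0"
  by (simp add: exchange_def skew_nonzero)

lemma exchange_skew: "exchange i j = \<theta> $ i $ j * exchange j i"
proof (cases "i = j")
  case True
  then show ?thesis by (simp add: skew_diagonal)
next
  case False
  then have "index i \<noteq> index j"
    using inj_index by (auto dest: injD)
  then show ?thesis
    using skew_nonzero[of i j] by (simp add: exchange_def skew_inverse[of j i] linorder_neq_iff) auto
qed

lemma letter_weight_nonzero: "letter_weight i p \<noteq> 0"
  by (simp add: letter_weight_def exchange_nonzero)

lemma letter_weight_add: "letter_weight i (p + q) = letter_weight i p * letter_weight i q"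
  by (simp add: letter_weight_def power_int_add exchange_nonzero prod.distrib)

lemma letter_weight_axis: "letter_weight i (axis j 1) = exchange j i"
proof -
  have "letter_weight i (axis j 1) = (\<Prod>l\<in>UNIV. if l = j then exchange j i else 1)"
    unfolding letter_weight_def by (rule prod.cong) (auto simp: axis_def)
  then show ?thesis by simp
qed

lemma weight_nonzero: "weight p w \<noteq> 0"
  by (induction w arbitrary: p) (simp_all add: letter_weight_nonzero)

text \<open>This cocycle identity is the rule for products of a twisting system, on words.\<close>

lemma weight_append: "weight p (v @ w) = weight p v * weight (p + word_degree (Word v)) w"
proof (induction v arbitrary: p)
  case Nil
  have "word_degree (Word [] :: 'n free_mon) = 0"
    using word_degree_0 by (simp add: zero_free_mon_def)
  then show ?case by simp
next
  case (Cons i v)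
  then show ?case by (simp add: word_degree_Cons add.assoc)
qed

text \<open>
  The factors for the two letters agree on both sides except for the contribution of the first
  letter to the degree that the second one sees, that is \<open>\<chi> e_i e_j\<close> against \<open>\<chi> e_j e_i\<close>.
\<close>

lemma weight_swap: "weight p (i # j # w) = \<theta> $ i $ j * weight p (j # i # w)"
  by (simp add: letter_weight_add letter_weight_axis exchange_skew[of i j] add.assoc
      add.commute[of "axis i 1"])

definition straighten :: "int ^ 'n \<Rightarrow> ('n free_mon \<Rightarrow>\<^sub>0 'k) \<Rightarrow> (('n \<Rightarrow>\<^sub>0 nat) \<Rightarrow>\<^sub>0 'k)" where
  "straighten p = monomial_map word_content (\<lambda>w. weight p (letters w))"

lemma straighten_add: "straighten p (f + g) = straighten p f + straighten p g"
  by (simp add: straighten_def monomial_map_add)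

lemma straighten_diff: "straighten p (f - g) = straighten p f - straighten p g"
  by (simp add: straighten_def monomial_map_diff)

lemma straighten_single:
  "straighten p (Poly_Mapping.single w c) = Poly_Mapping.single (word_content w) (weight p (letters w) * c)"
  by (simp add: straighten_def)

lemma straighten_zero [simp]: "straighten p 0 = 0"
  by (simp add: straighten_def)

lemma straighten_one [simp]: "straighten p 1 = 1"
  unfolding single_one[symmetric] straighten_single by simp

text \<open>By linearity in both arguments this is the cocycle identity for weights.\<close>

lemma straighten_mult:
  assumes "\<And>w. w \<in> Poly_Mapping.keys f \<Longrightarrow> word_degree w = q"
  shows "straighten p (f * g) = straighten p f * straighten (p + q) g"
proof -
  have "Poly_Mapping.keys f \<subseteq> {w. word_degree w = q}"
    using assms by blast
  then show ?thesis
  proof (induction f rule: poly_mapping_additive_induct)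
    case (single v c)
    show ?case
      using subset_UNIV
    proof (induction g rule: poly_mapping_additive_induct)
      case (single w d)
      then show ?case
        using \<open>v \<in> _\<close> weight_append[of p "letters v" "letters w"]
        by (simp add: straighten_single mult_single word_content_plus ac_simps)
    qed (simp_all add: straighten_add distrib_left)
  qed (simp_all add: straighten_add distrib_right)
qed

lemma straighten_scal:
  "straighten p (scal c * f) = Poly_Mapping.single 0 c * straighten p f"
proof -
  have "straighten p (scal c * f) = straighten p (scal c) * straighten (p + 0) f"
    by (rule straighten_mult) (auto simp: scal_def word_degree_0 split: if_splits)
  then show ?thesis
    by (simp add: scal_def straighten_single)
qed


section \<open>Straightening computes the quotient by the defining ideal\<close>

abbreviation word :: "'n list \<Rightarrow> ('n free_mon \<Rightarrow>\<^sub>0 'k)" where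
  "word w \<equiv> Poly_Mapping.single (Word w) 1"

lemma skew_ideal: "ideal (skew_ideal \<theta>) ring_of_type_algebra"
  unfolding skew_ideal_def
  by (rule ring.genideal_ideal[OF ring_of_noncommutative_type]) simp

lemma skew_ideal_zero: "0 \<in> skew_ideal \<theta>"
  and skew_ideal_add: "\<lbrakk>f \<in> skew_ideal \<theta>; g \<in> skew_ideal \<theta>\<rbrakk> \<Longrightarrow> f + g \<in> skew_ideal \<theta>"
  and skew_ideal_mult_left: "f \<in> skew_ideal \<theta> \<Longrightarrow> h * f \<in> skew_ideal \<theta>"
  and skew_ideal_mult_right: "f \<in> skew_ideal \<theta> \<Longrightarrow> f * h \<in> skew_ideal \<theta>"
  and skew_ideal_minus: "f \<in> skew_ideal \<theta> \<Longrightarrow> - f \<in> skew_ideal \<theta>"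
proof -
  interpret ideal "skew_ideal \<theta>" ring_of_type_algebra by (rule skew_ideal)
  show "0 \<in> skew_ideal \<theta>" using additive_subgroup.zero_closed[OF is_additive_subgroup] by simp
  show "\<lbrakk>f \<in> skew_ideal \<theta>; g \<in> skew_ideal \<theta>\<rbrakk> \<Longrightarrow> f + g \<in> skew_ideal \<theta>" using additive_subgroup.a_closed[OF is_additive_subgroup, of f g] by simp
  show "f \<in> skew_ideal \<theta> \<Longrightarrow> h * f \<in> skew_ideal \<theta>" using I_l_closed[of f h] by simp
  show "f \<in> skew_ideal \<theta> \<Longrightarrow> f * h \<in> skew_ideal \<theta>" using I_r_closed[of f h] by simp
  show "f \<in> skew_ideal \<theta> \<Longrightarrow> - f \<in> skew_ideal \<theta>" using I_l_closed[of f "- 1"] by simp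
qed

lemma straighten_relation:
  "straighten p (Poly_Mapping.single u c * (gen i * gen j - scal (\<theta> $ i $ j) * gen j * gen i)
    * Poly_Mapping.single v d) = 0"
proof -
  have "straighten p (Poly_Mapping.single (Word (letters u @ i # j # letters v)) (c * d))
      = straighten p (Poly_Mapping.single (Word (letters u @ j # i # letters v)) (c * \<theta> $ i $ j * d))"
  proof -
    have "word_content (Word (letters u @ i # j # letters v))
        = word_content (Word (letters u @ j # i # letters v))"
      by (rule poly_mapping_eqI) simp
    moreover have "weight p (letters u @ i # j # letters v)
        = \<theta> $ i $ j * weight p (letters u @ j # i # letters v)"
      unfolding weight_append[of p "letters u"] weight_swap[of _ i j] by (rule mult.left_commute)
    ultimately show ?thesis
      by (simp add: straighten_single ac_simps)
  qed
  then show ?thesis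
    by (simp add: gen_def scal_def algebra_simps straighten_diff mult_single)
      (simp add: plus_free_mon_def zero_free_mon_def)
qed

text \<open>
  The kernel of a single \<open>straighten p\<close> is not visibly an ideal, because the map is
  multiplicative on homogeneous factors only. The elements whose multiples by monomials on both sides
  are all annihilated do form a two-sided ideal, and it contains the relations.
\<close>

lemma straighten_skew_ideal:
  assumes "f \<in> skew_ideal \<theta>"
  shows "straighten p f = 0"
proof -
  define J where "J = {f. \<forall>u c v d p.
    straighten p (Poly_Mapping.single u c * f * Poly_Mapping.single v d) = 0}"
  have zero: "0 \<in> J"
    by (simp add: J_def)
  have add: "f + g \<in> J" if "f \<in> J" "g \<in> J" for f g
    using that by (simp add: J_def distrib_left distrib_right straighten_add)
  have minus: "- f \<in> J" if "f \<in> J" for f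
  proof -
    have "- f = 0 - f" by simp
    then show ?thesis
      using that by (simp only: J_def mem_Collect_eq right_diff_distrib left_diff_distrib
          straighten_diff) simp
  qed
  have left: "h * f \<in> J" if "f \<in> J" for h f
    using subset_UNIV
  proof (induction h rule: poly_mapping_additive_induct)
    case (single w e)
    then show ?case
      using that by (simp add: J_def mult_single flip: mult.assoc)
  qed (simp_all add: zero add distrib_right)
  have right: "f * h \<in> J" if "f \<in> J" for h f
    using subset_UNIV
  proof (induction h rule: poly_mapping_additive_induct)
    case (single w e)
    then show ?case
      using that by (simp add: J_def mult_single mult.assoc)
  qed (simp_all add: zero add distrib_left)
  have "ideal J ring_of_type_algebra"
  proof (intro idealI ring_of_noncommutative_type)
    show "subgroup J (add_monoid ring_of_type_algebra)"
    proof (rule subgroup.intro)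
      show "inv\<^bsub>add_monoid ring_of_type_algebra\<^esub> f \<in> J" if "f \<in> J" for f
        using minus[OF that] a_inv_ring_of_type[of f] by (simp only: a_inv_def)
    qed (simp_all add: zero add)
  qed (simp_all add: left right)
  moreover have "{gen i * gen j - scal (\<theta> $ i $ j) * gen j * gen i |i j. True} \<subseteq> J"
    using straighten_relation by (auto simp: J_def)
  ultimately have "skew_ideal \<theta> \<subseteq> J"
    unfolding skew_ideal_def
    by (rule ring.genideal_minimal[OF ring_of_noncommutative_type])
  with assms have "f \<in> J" by blast
  then have "straighten p (Poly_Mapping.single 0 1 * f * Poly_Mapping.single 0 1) = 0"
    unfolding J_def by blast
  then show ?thesis by simp
qed

text \<open>
  The factor is left unspecified: it is determined afterwards by comparing weights, since
  straightening annihilates the ideal.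
\<close>

definition proportional :: "'n list \<Rightarrow> 'n list \<Rightarrow> bool" where
  "proportional v w \<longleftrightarrow> (\<exists>c. word v - scal c * word w \<in> skew_ideal \<theta>)"

lemma proportional_refl: "proportional w w"
  unfolding proportional_def by (rule exI[of _ 1]) (simp add: scal_def skew_ideal_zero)

lemma proportional_trans:
  assumes "proportional u v" "proportional v w"
  shows "proportional u w"
proof -
  obtain c d where "word u - scal c * word v \<in> skew_ideal \<theta>" "word v - scal d * word w \<in> skew_ideal \<theta>"
    using assms unfolding proportional_def by blast
  then have "(word u - scal c * word v) + scal c * (word v - scal d * word w) \<in> skew_ideal \<theta>"
    by (intro skew_ideal_add skew_ideal_mult_left)
  also have "(word u - scal c * word v) + scal c * (word v - scal d * word w)
      = word u - scal (c * d) * word w"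
    by (simp add: right_diff_distrib scal_def mult_single flip: mult.assoc)
  finally show ?thesis
    unfolding proportional_def by blast
qed

lemma proportional_Cons:
  assumes "proportional v w"
  shows "proportional (i # v) (i # w)"
proof -
  obtain c where "word v - scal c * word w \<in> skew_ideal \<theta>"
    using assms unfolding proportional_def by blast
  then have "word [i] * (word v - scal c * word w) \<in> skew_ideal \<theta>"
    by (rule skew_ideal_mult_left)
  also have "word [i] * (word v - scal c * word w) = word (i # v) - scal c * word (i # w)"
    by (simp add: right_diff_distrib scal_def mult_single plus_free_mon_def zero_free_mon_def)
  finally show ?thesis
    unfolding proportional_def by blast
qed

lemma proportional_swap: "proportional (i # j # w) (j # i # w)"
proof -
  have "gen i * gen j - scal (\<theta> $ i $ j) * gen j * gen i \<in> skew_ideal \<theta>"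
    unfolding skew_ideal_def
    by (rule subsetD[OF ring.genideal_self[OF ring_of_noncommutative_type]]) auto
  then have "(gen i * gen j - scal (\<theta> $ i $ j) * gen j * gen i) * word w \<in> skew_ideal \<theta>"
    by (rule skew_ideal_mult_right)
  also have "(gen i * gen j - scal (\<theta> $ i $ j) * gen j * gen i) * word w
      = word (i # j # w) - scal (\<theta> $ i $ j) * word (j # i # w)"
    by (simp add: left_diff_distrib gen_def scal_def mult_single plus_free_mon_def zero_free_mon_def)
  finally show ?thesis
    unfolding proportional_def by blast
qed

lemma proportional_move: "proportional (i # u @ v) (u @ i # v)"
proof (induction u)
  case Nil
  show ?case by (simp add: proportional_refl)
next
  case (Cons j u)
  then show ?case
    using proportional_swap proportional_Cons proportional_trans by (metis append_Cons)
qed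

text \<open>
  Move the first letter of one word to the front of the other one, by exchanges of neighbours, and
  continue with the rest.
\<close>

lemma proportional_if_same_letters:
  assumes "\<And>i. count_list v i = count_list w i"
  shows "proportional v w"
  using assms
proof (induction v arbitrary: w)
  case Nil
  then have "w = []"
    by (metis count_list_0_iff count_list.simps(1) list.set_intros(1) neq_Nil_conv)
  then show ?case by (simp add: proportional_refl)
next
  case (Cons i v)
  then have "count_list w i \<noteq> 0"
    by (metis count_list.simps(2) nat.simps(3) add_is_0 one_neq_zero)
  then obtain a b where w: "w = a @ i # b"
    by (metis count_notin split_list)
  have "count_list v j = count_list (a @ b) j" for j
    using Cons.prems[of j] by (simp add: w split: if_splits)
  then have "proportional (i # v) (i # a @ b)"
    by (intro proportional_Cons Cons.IH)
  then show ?case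
    using proportional_move proportional_trans unfolding w by blast
qed

text \<open>The section of \<open>straighten p\<close> with values in the span of the normal words.\<close>

definition unstraighten :: "int ^ 'n \<Rightarrow> (('n \<Rightarrow>\<^sub>0 nat) \<Rightarrow>\<^sub>0 'k) \<Rightarrow> ('n free_mon \<Rightarrow>\<^sub>0 'k)" where
  "unstraighten p = monomial_map normal_word (\<lambda>m. inverse (weight p (letters (normal_word m))))"

lemma straighten_unstraighten [simp]: "straighten p (unstraighten p h) = h"
  using subset_UNIV
  by (induction h rule: poly_mapping_additive_induct)
    (simp_all add: unstraighten_def monomial_map_add straighten_add straighten_single
      weight_nonzero flip: mult.assoc)

text \<open>
  It suffices to treat a word. It is proportional to the normal word with the same letters, and the
  factor is the quotient of their weights, which is exactly what the section divides by.
\<close>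

lemma unstraighten_straighten: "f - unstraighten p (straighten p f) \<in> skew_ideal \<theta>"
  using subset_UNIV
proof (induction f rule: poly_mapping_additive_induct)
  case zero
  show ?case by (simp add: unstraighten_def skew_ideal_zero)
next
  case (single w c)
  let ?n = "normal_word (word_content w)"
  have "count_list (letters w) i = count_list (letters ?n) i" for i
    by (metis lookup_word_content word_content_normal_word)
  then obtain e where e: "word (letters w) - scal e * word (letters ?n) \<in> skew_ideal \<theta>"
    using proportional_if_same_letters unfolding proportional_def by blast
  have "straighten p (word (letters w)) = Poly_Mapping.single 0 e * straighten p (word (letters ?n))"
    using straighten_skew_ideal[OF e, of p] by (simp add: straighten_diff straighten_scal)
  then have "weight p (letters w) = e * weight p (letters ?n)"
    by (simp add: straighten_single mult_single inj_eq[OF inj_single])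
  then have "unstraighten p (straighten p (Poly_Mapping.single w c)) = Poly_Mapping.single ?n (e * c)"
    by (simp add: straighten_single unstraighten_def weight_nonzero field_simps)
  moreover have "scal c * (word (letters w) - scal e * word (letters ?n)) \<in> skew_ideal \<theta>"
    by (rule skew_ideal_mult_left[OF e])
  ultimately show ?case
    by (simp add: right_diff_distrib scal_def mult_single mult.commute[of e])
next
  case (add f g)
  then show ?case
    using skew_ideal_add[OF add.IH]
    by (simp add: straighten_add unstraighten_def monomial_map_add algebra_simps)
qed

lemma skew_class_eq_iff_diff: "skew_class \<theta> f = skew_class \<theta> g \<longleftrightarrow> f - g \<in> skew_ideal \<theta>"
proof -
  have cl: "skew_class \<theta> f = {h + f |h. h \<in> skew_ideal \<theta>}" for f
    by (auto simp: skew_class_def a_r_coset_def r_coset_def)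
  show ?thesis
  proof
    assume "skew_class \<theta> f = skew_class \<theta> g"
    moreover have "f \<in> skew_class \<theta> f"
      using skew_ideal_zero by (force simp: cl)
    ultimately show "f - g \<in> skew_ideal \<theta>"
      by (auto simp: cl)
  next
    assume fg: "f - g \<in> skew_ideal \<theta>"
    have "h + f = (h + (f - g)) + g" "h + g = (h + - (f - g)) + f" for h
      by simp_all
    then show "skew_class \<theta> f = skew_class \<theta> g"
      unfolding cl using skew_ideal_add fg skew_ideal_minus[OF fg] by blast
  qed
qed

text \<open>
  The kernel of \<open>straighten p\<close> is the defining ideal, for every \<open>p\<close>. In the proofs below the
  index \<open>p\<close> can therefore be chosen to suit the identity at hand.
\<close>

lemma skew_class_eq_iff: "skew_class \<theta> f = skew_class \<theta> g \<longleftrightarrow> straighten p f = straighten p g"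
proof
  assume "skew_class \<theta> f = skew_class \<theta> g"
  then show "straighten p f = straighten p g"
    using straighten_skew_ideal[of "f - g" p] by (simp add: skew_class_eq_iff_diff straighten_diff)
next
  assume "straighten p f = straighten p g"
  then have "f - g = (f - unstraighten p (straighten p f)) + - (g - unstraighten p (straighten p g))"
    by simp
  then show "skew_class \<theta> f = skew_class \<theta> g"
    unfolding skew_class_eq_iff_diff
    using skew_ideal_add[OF unstraighten_straighten skew_ideal_minus[OF unstraighten_straighten]]
    by metis
qed

lemma skew_poly_algebra_simps:
  "carrier (skew_poly_algebra \<theta>) = range (skew_class \<theta>)"
  "\<one>\<^bsub>skew_poly_algebra \<theta>\<^esub> = skew_class \<theta> 1"
  "\<zero>\<^bsub>skew_poly_algebra \<theta>\<^esub> = skew_class \<theta> 0"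
  "skew_class \<theta> f \<oplus>\<^bsub>skew_poly_algebra \<theta>\<^esub> skew_class \<theta> g = skew_class \<theta> (f + g)"
  "skew_class \<theta> f \<otimes>\<^bsub>skew_poly_algebra \<theta>\<^esub> skew_class \<theta> g = skew_class \<theta> (f * g)"
  "c \<odot>\<^bsub>skew_poly_algebra \<theta>\<^esub> skew_class \<theta> f = skew_class \<theta> (Poly_Mapping.single 0 c * f)"
  "homog (skew_poly_algebra \<theta>) p = skew_class \<theta> ` {f. \<forall>w \<in> Poly_Mapping.keys f. word_degree w = p}"
proof -
  interpret ideal "skew_ideal \<theta>" ring_of_type_algebra by (rule skew_ideal)
  note defs = skew_poly_algebra_def skew_poly_ring_def FactRing_def skew_class_def
  show "carrier (skew_poly_algebra \<theta>) = range (skew_class \<theta>)"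
    by (auto simp: defs A_RCOSETS_def RCOSETS_def a_r_coset_def)
  show "\<zero>\<^bsub>skew_poly_algebra \<theta>\<^esub> = skew_class \<theta> 0"
    by (auto simp: defs a_r_coset_def r_coset_def)
  show "skew_class \<theta> f \<oplus>\<^bsub>skew_poly_algebra \<theta>\<^esub> skew_class \<theta> g = skew_class \<theta> (f + g)"
    using a_rcos_sum[of f g] by (simp add: defs)
  have mult: "skew_class \<theta> f \<otimes>\<^bsub>skew_poly_ring \<theta>\<^esub> skew_class \<theta> g = skew_class \<theta> (f * g)" for f g
    using rcoset_mult_add[of f g] by (simp add: defs)
  then show "skew_class \<theta> f \<otimes>\<^bsub>skew_poly_algebra \<theta>\<^esub> skew_class \<theta> g = skew_class \<theta> (f * g)"
    by (simp add: skew_poly_algebra_def)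
  show "c \<odot>\<^bsub>skew_poly_algebra \<theta>\<^esub> skew_class \<theta> f = skew_class \<theta> (Poly_Mapping.single 0 c * f)"
    by (simp add: skew_poly_algebra_def mult flip: scal_def)
qed (simp_all add: skew_poly_algebra_def skew_poly_ring_def FactRing_def skew_class_def)

lemma graded_k_algebra_skew: "graded_k_algebra (skew_poly_algebra \<theta>)"
  by (rule graded_k_algebra_quotientI[where cl = "skew_class \<theta>" and deg = word_degree])
    (simp_all add: skew_poly_algebra_simps word_degree_0 word_degree_plus)

end

section \<open>The twisting system of a skew polynomial algebra\<close>

lemma poly_algebra_simps:
  "carrier poly_algebra = UNIV"
  "\<one>\<^bsub>poly_algebra\<^esub> = 1"
  "\<zero>\<^bsub>poly_algebra\<^esub> = 0"
  "f \<oplus>\<^bsub>poly_algebra\<^esub> g = f + g"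
  "f \<otimes>\<^bsub>poly_algebra\<^esub> g = f * g"
  "c \<odot>\<^bsub>poly_algebra\<^esub> f = Poly_Mapping.single 0 c * f"
  "homog poly_algebra p = {f. \<forall>m \<in> Poly_Mapping.keys f. monom_degree m = p}"
  by (simp_all add: poly_algebra_def)

lemma graded_k_algebra_poly: "graded_k_algebra poly_algebra"
  by (rule graded_k_algebra_quotientI[where cl = "\<lambda>f. f" and deg = monom_degree])
    (simp_all add: poly_algebra_simps monom_degree_0 monom_degree_plus)

context skew_parameters
begin

lemma word_degree_normal_word: "word_degree (normal_word m) = monom_degree m"
  by (metis monom_degree_word_content word_content_normal_word)

lemma keys_unstraighten:
  assumes "\<forall>m \<in> Poly_Mapping.keys h. monom_degree m = q"
  shows "\<forall>w \<in> Poly_Mapping.keys (unstraighten p h). word_degree w = q"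
  using assms keys_monomial_map unfolding unstraighten_def
  by (metis word_degree_normal_word)

lemma keys_straighten:
  assumes "\<forall>w \<in> Poly_Mapping.keys f. word_degree w = q"
  shows "\<forall>m \<in> Poly_Mapping.keys (straighten p f). monom_degree m = q"
  using assms keys_monomial_map unfolding straighten_def
  by (metis monom_degree_word_content)

text \<open>
  Each axiom about \<open>skew_class \<theta> (unstraighten p h)\<close> is checked after applying \<open>straighten p\<close>, which
  recovers \<open>h\<close>; the rule for products then is the one of \<open>straighten\<close>.
\<close>

lemma skew_twisting_system:
  "twisting_system poly_algebra (skew_poly_algebra \<theta>) (\<lambda>p h. skew_class \<theta> (unstraighten p h))"
proof (intro twisting_system.intro twisting_system_axioms.intro graded_k_algebra_poly
    graded_k_algebra_skew, goal_cases)
  case (1 p)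
  show ?case
    unfolding bij_betw_def inj_on_def poly_algebra_simps skew_poly_algebra_simps
    by (auto simp: skew_class_eq_iff[of _ _ p])
next
  case (2 a a' p)
  then show ?case
    by (simp add: poly_algebra_simps skew_poly_algebra_simps unstraighten_def monomial_map_add)
next
  case (3 a p c)
  then show ?case
    by (simp add: poly_algebra_simps skew_poly_algebra_simps skew_class_eq_iff[of _ _ p]
        straighten_scal flip: scal_def[of c])
next
  case (4 p)
  then show ?case
    by (simp add: poly_algebra_simps skew_poly_algebra_simps skew_class_eq_iff[of _ _ p])
next
  case (5 p q)
  show ?case
  proof (intro equalityI subsetI)
    fix x assume "x \<in> (\<lambda>h. skew_class \<theta> (unstraighten p h)) ` homog poly_algebra q"
    then show "x \<in> homog (skew_poly_algebra \<theta>) q"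
      using keys_unstraighten by (auto simp: poly_algebra_simps skew_poly_algebra_simps)
  next
    fix x assume "x \<in> homog (skew_poly_algebra \<theta>) q"
    then obtain f where f: "x = skew_class \<theta> f" "\<forall>w \<in> Poly_Mapping.keys f. word_degree w = q"
      by (auto simp: skew_poly_algebra_simps)
    have "x = skew_class \<theta> (unstraighten p (straighten p f))"
      by (simp add: f(1) skew_class_eq_iff[of _ _ p])
    then show "x \<in> (\<lambda>h. skew_class \<theta> (unstraighten p h)) ` homog poly_algebra q"
      using keys_straighten[OF f(2)] by (auto simp: poly_algebra_simps)
  qed
next
  case (6 a q a' p)
  then have "\<forall>w \<in> Poly_Mapping.keys (unstraighten p a). word_degree w = q"
    by (intro keys_unstraighten) (simp add: poly_algebra_simps)
  then show ?case
    by (simp add: poly_algebra_simps skew_poly_algebra_simps skew_class_eq_iff[of _ _ p]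
        straighten_mult[of _ q])
qed

end

theorem corollary5p9:
  fixes \<theta> :: "'k :: field ^ 'n ^ 'n"
  assumes "mult_skew_symmetric \<theta>"
  shows "equivalent_categories
           (tilde_cat (skew_poly_algebra \<theta>))
           (tilde_cat (poly_algebra :: ('k, ('n \<Rightarrow>\<^sub>0 nat) \<Rightarrow>\<^sub>0 'k, int ^ 'n) graded_algebra)) \<and>
         equivalent_categories
           (gr_mod_cat TYPE('m) (skew_poly_algebra \<theta>))
           (gr_mod_cat TYPE('m) (poly_algebra :: ('k, ('n \<Rightarrow>\<^sub>0 nat) \<Rightarrow>\<^sub>0 'k, int ^ 'n) graded_algebra))"
proof -
  interpret skew_parameters \<theta>
    by (rule skew_parameters.intro) (rule assms)
  have "twisting_system (skew_poly_algebra \<theta>) poly_algebra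
      (twisting_system.untwist poly_algebra (\<lambda>p h. skew_class \<theta> (unstraighten p h)))"
    by (rule twisting_system.inverse_twisting_system[OF skew_twisting_system])
  then show ?thesis
    using twisting_system.tilde_cat_equivalent twisting_system.gr_mod_cat_equivalent by blast
qed

end
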